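(* Consider the blockchain-based federated learning protocol described in the context, with $2f_s+1$ servers of which at most $f_s$ are Byzantine and $f_r+1$ storage replicas of which at most $f_r$ are Byzantine. If a model owner sets up a federated learning task, then eventually the model owner obtains a trained model.
   Context: Processes. The system is a finite set of message-passing processes: clients, a set $S$ of $2f_s+1$ servers, a set $R$ of $f_r+1$ storage replicas, and a correct model owner, all with access to a blockchain (an immutable, totally ordered ledger). Byzantine processes behave arbitrarily; the others are correct and follow the protocol. At most $f_s$ servers and $f_r$ replicas are Byzantine. Messages are signed, and signatures cannot be forged. Messages between correct processes are eventually received, and a transaction sent to the blockchain by a correct process is eventually totally ordered in it. Local computations terminate. $h$ is a cryptographic hash function, idealized as collision-free. All messages, events and sets below are indexed by the round they concern. Storage. A correct replica receiving $\langle k,v\rangle$ stores $v$ under hash-key $k$ forever if $k=h(v)$, and rejects it otherwise; it answers queries for $k$ with the stored value. To read a value $v$ given its proof, a process verifies the proof, queries all replicas for $h(v)$, and returns the first reply $\ell'$ with $h(\ell')=h(v)$. Proof of Availability and Integrity. $P(\mathrm{tag},v)$ is a set of signatures on $h(v)$ (for the given tag and round) by $f_s+1$ distinct servers. Procedure build$(\mathrm{tag},v)$ at server $i$: if $\mathrm{locally\_valid}(\mathrm{tag},v)$ holds then, when tag is UPDATE or MODEL, send $\langle h(v),v\rangle$ to all replicas; when tag is MODEL, also send $\langle \mathrm{MODEL},v\rangle$ to all servers; then in all cases send a local proof (the signed hash $h(v)_i$ with its tag) to all servers. A server receiving $\langle\mathrm{MODEL},v\rangle$ for the first time, if $\mathrm{locally\_valid}(\mathrm{MODEL},v)$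 holds, sends $\langle h(v),v\rangle$ to all replicas and its local proof to all servers. A server that has received local proofs for the same $(\mathrm{tag},h(v))$ from $f_s+1$ distinct servers forms $P(\mathrm{tag},v)$. Local validity: an update of client $k$ for round $t$ is valid if correctly formatted and $k\in C_t$; a client set, and the rewarding information, is the output of the same deterministic computation at all correct servers and needs no further check; a model $v$ of round $t$ is valid at server $p$ if it is $\epsilon$-close to the model $w_t^p$ computed by $p$ in round $t$. Setup. The model owner starts a task by a transaction recording on-chain the hash-key of the initial model (placed in the storage) and the task parameters, including the minimum number $m$ of updates to aggregate, the acceptance vector gap $\epsilon\in\mathbb{R}^d$ and a halting condition, which determines the last learning round $t_{fin}$. Clients join by transactions; once enough clients have joined, the servers select the first client set with the pseudo-random function select_clients (all correct servers obtain the same output), build its proof and announce it on-chain. Learning rounds are $t=0,1,\dots,t_{fin}$, with $t_{fin}$ finite. Round $t$. (a) Each correct client $k\in C_t$ retrieves a model from the storage (if $t=0$, the initial model through the hash-key recorded on-chain; if $t\ge1$, a model of round $t-1$ with a valid proof received from the servers), computes its update $g_t^k$, signs it and sends it to all servers. (b) A correct server, on first receiving $g_t^k$ from $k\in C_t$, runs build$(\mathrm{UPDATE},g_t^k)$. (c) When a correct server first holds proofs for at least $m$ updates of round $t$ (its candidate set $\mathcal{P}(G_t)_{cand}$), it computes $C_{t+1}$ by select_clients and runs build$(\mathrm{CLIENTS},C_{t+1})$; once it holds $P(\mathrm{CLIENTS},C_{t+1})$ it sends to the blockchain a new-round transaction containing $t$, $\mathcal{P}(G_t)_{cand}$, $C_{t+1}$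 and $P(\mathrm{CLIENTS},C_{t+1})$. In round $t_{fin}$ the client set is replaced by the rewarding information. (d) The first valid new-round transaction for round $t$ on the blockchain fixes the committed set of update proofs (nonempty). Each correct server then reads from the storage the committed updates it lacks, computes its aggregated model $w_t^p$ with a robust aggregation function (e.g. coordinate-wise median) and runs build$(\mathrm{MODEL},w_t^p)$. (e) When a correct server holds a proof for an aggregated model of round $t$, it sends it to the clients and moves to round $t+1$. End of the task. Each correct server knows when training terminates (round $t_{fin}$). Once it holds a proof for the rewarding information and a proof for an aggregated model of round $t_{fin}$, it sends a final transaction carrying them to the blockchain. The model owner, upon seeing on-chain such a transaction with valid proofs, reads the final model from the storage; the trained model obtained is this model. Standing assumptions. Two models $w,w'\in\mathbb{R}^d$ are $\epsilon$-close if $|w_i-w'_i|\le\epsilon_i$ for every coordinate $i$. (1) For each round $t$, every two models produced in round $t$ by correct servers via the robust aggregation function are $\epsilon$-close. (2) The set of clients that join the task (enough for the task to start) is such that every set returned by select_clients contains less than half Byzantine clients, and enough correct clients to produce the number $m$ of updates needed for the robust aggregation. *)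

theory Defs
  imports "HOL-Analysis.Analysis"
begin

text \<open>
  The protocol is a labelled transition system over global states. An execution is an infinite
  sequence of states in which every step is a protocol step of a correct process, an arbitrary step
  of a Byzantine process (short of forging), a message delivery, the ordering of a transaction, or
  a stuttering step. Executions are asynchronous; the only progress assumptions are those in
  \<open>fair\<close>.

  Type variables: \<open>'p\<close> processes, \<open>'g\<close> contents of client updates, \<open>'n\<close> index type of the model
  space, \<open>'i\<close> rewarding information, \<open>'h\<close> hash values.
\<close>


section \<open>Values, signatures, messages, transactions\<close>

type_synonym 'n model = "real ^ 'n"

text \<open>\<open>UpdateV k t g\<close> is the update with content \<open>g\<close> signed by client \<open>k\<close> in round \<open>t\<close>.\<close>

datatype ('p, 'g, 'n::finite, 'i) data =
    UpdateV 'p nat 'g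
  | ModelV "'n model"
  | ClientsV "'p set"
  | RewardV 'i

datatype tag = UPDATE | MODEL | CLIENTS | REWARD

datatype ('p, 'h) sig = Sig (signer: 'p) tag nat 'h

type_synonym ('p, 'h) proof_set = "('p, 'h) sig set"

text \<open>
  A message is a triple of sender, receiver and payload; the sender component is the sender's
  signature, so \<open>(q, p, LocalProof tag t x)\<close> carries the signature \<open>Sig q tag t x\<close>.
  \<open>ModelProof t x \<pi>\<close> announces to the clients the hash and the proof of a model of round \<open>t\<close>.
\<close>

datatype ('p, 'g, 'n::finite, 'i, 'h) payload =
    Store 'h "('p, 'g, 'n, 'i) data"
  | Query 'h
  | Reply "('p, 'g, 'n, 'i) data"
  | UpdateMsg nat 'g
  | ModelMsg nat "'n model"
  | LocalProof tag nat 'h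
  | ModelProof nat 'h "('p, 'h) proof_set"

type_synonym ('p, 'g, 'n, 'i, 'h) msg = "'p \<times> 'p \<times> ('p, 'g, 'n, 'i, 'h) payload"

text \<open>The halting condition is represented by the last learning round that it determines.\<close>

record 'n task =
  min_updates :: nat
  gap :: "'n model"
  last_round :: nat

text \<open>
  \<open>TxRound t K v \<pi>\<close> carries the candidate set \<open>K\<close> of update proofs of round \<open>t\<close> and the next client
  set (in the last round, the rewarding information) \<open>v\<close> with its proof \<open>\<pi>\<close>. \<open>TxFinal v \<pi> x \<pi>'\<close>
  carries the rewarding information \<open>v\<close> with its proof \<open>\<pi>\<close>, and the hash \<open>x\<close> of a model of the last
  round with its proof \<open>\<pi>'\<close>.
\<close>

datatype ('p, 'g, 'n::finite, 'i, 'h) tx =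
    TxStart 'h "'n task"
  | TxJoin
  | TxFirst "('p, 'g, 'n, 'i) data" "('p, 'h) proof_set"
  | TxRound nat "('p, 'h) proof_set set" "('p, 'g, 'n, 'i) data" "('p, 'h) proof_set"
  | TxFinal "('p, 'g, 'n, 'i) data" "('p, 'h) proof_set" 'h "('p, 'h) proof_set"

text \<open>The first component is the sender of the transaction.\<close>

type_synonym ('p, 'g, 'n, 'i, 'h) stx = "'p \<times> ('p, 'g, 'n, 'i, 'h) tx"


section \<open>System parameters\<close>

text \<open>
  \<open>aggregate\<close> takes the server as an argument because the models computed by different correct
  servers from the same committed updates are only assumed to be close, not equal.
  \<open>reward\<close> is computed from the sets of update proofs committed in the rounds before the last one,
  and \<open>select_clients\<close> from the set of enrolled clients and the round, so that all correct servers
  obtain the same output.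
  \<open>min_clients\<close> is the number of clients that must join for the task to start.
\<close>

record ('p, 'g, 'n, 'i, 'h) system =
  clients :: "'p set"
  servers :: "'p set"
  replicas :: "'p set"
  owner :: 'p
  byz :: "'p set"
  f_s :: nat
  f_r :: nat
  hash :: "('p, 'g, 'n, 'i) data \<Rightarrow> 'h"
  well_formatted :: "'g \<Rightarrow> bool"
  train :: "'p \<Rightarrow> nat \<Rightarrow> 'n model \<Rightarrow> 'g"
  aggregate :: "'p \<Rightarrow> nat \<Rightarrow> ('p \<times> 'g) set \<Rightarrow> 'n model"
  select_clients :: "'p set \<Rightarrow> nat \<Rightarrow> 'p set"
  reward :: "('p, 'h) proof_set set option list \<Rightarrow> 'i"
  initial_model :: "'n model"
  min_clients :: nat
  the_task :: "'n task"

abbreviation m_min :: "('p, 'g, 'n::finite, 'i, 'h) system \<Rightarrow> nat" where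
  "m_min P \<equiv> min_updates (the_task P)"

abbreviation t_fin :: "('p, 'g, 'n::finite, 'i, 'h) system \<Rightarrow> nat" where
  "t_fin P \<equiv> last_round (the_task P)"

text \<open>A positive minimum number of updates makes the committed sets nonempty.\<close>

definition well_formed :: "('p, 'g, 'n::finite, 'i, 'h) system \<Rightarrow> bool" where
  "well_formed P \<longleftrightarrow>
     finite (clients P) \<and> owner P \<notin> byz P \<and> inj (hash P) \<and>
     (\<forall>k t w. well_formatted P (train P k t w)) \<and>
     (\<forall>J t. select_clients P J t \<subseteq> J) \<and>
     0 < m_min P"

definition eps_close :: "'n::finite model \<Rightarrow> 'n model \<Rightarrow> 'n model \<Rightarrow> bool" where
  "eps_close \<epsilon> w w' \<longleftrightarrow> (\<forall>i. \<bar>w $ i - w' $ i\<bar> \<le> \<epsilon> $ i)"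


section \<open>Proofs of availability and integrity, and the contents of the ledger\<close>

definition is_proof ::
  "('p, 'g, 'n::finite, 'i, 'h) system \<Rightarrow> tag \<Rightarrow> nat \<Rightarrow> 'h \<Rightarrow> ('p, 'h) proof_set \<Rightarrow> bool" where
  "is_proof P tag t x \<pi> \<longleftrightarrow>
     (\<exists>Q \<subseteq> servers P. card Q = f_s P + 1 \<and> \<pi> = (\<lambda>q. Sig q tag t x) ` Q)"

definition proved_hashes ::
  "('p, 'g, 'n::finite, 'i, 'h) system \<Rightarrow> tag \<Rightarrow> nat \<Rightarrow> ('p, 'h) proof_set set \<Rightarrow> 'h set" where
  "proved_hashes P tag t K = {x. \<exists>\<pi>\<in>K. is_proof P tag t x \<pi>}"

definition started :: "('p, 'g, 'n::finite, 'i, 'h) system \<Rightarrow> ('p, 'g, 'n, 'i, 'h) stx list \<Rightarrow> bool"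
  where "started P L \<longleftrightarrow>
    (owner P, TxStart (hash P (ModelV (initial_model P))) (the_task P)) \<in> set L"

definition joined ::
  "('p, 'g, 'n::finite, 'i, 'h) system \<Rightarrow> ('p, 'g, 'n, 'i, 'h) stx list \<Rightarrow> 'p set" where
  "joined P L = {k \<in> clients P. \<exists>A B. L = A @ (k, TxJoin) # B \<and> started P A}"

definition enough ::
  "('p, 'g, 'n::finite, 'i, 'h) system \<Rightarrow> ('p, 'g, 'n, 'i, 'h) stx list \<Rightarrow> bool" where
  "enough P L \<longleftrightarrow> started P L \<and> min_clients P \<le> card (joined P L)"

text \<open>The clients that have joined in the shortest prefix of the ledger containing enough of them.\<close>

definition enrolled ::
  "('p, 'g, 'n::finite, 'i, 'h) system \<Rightarrow> ('p, 'g, 'n, 'i, 'h) stx list \<Rightarrow> 'p set option" where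
  "enrolled P L =
     (if \<exists>n \<le> length L. enough P (take n L)
      then Some (joined P (take (LEAST n. enough P (take n L)) L)) else None)"

text \<open>
  Statements about \<open>C\<^sub>t\<close> are indexed by \<open>t\<close>; the rewarding information takes the place of
  \<open>C\<close> at index \<open>t_fin + 1\<close>.
\<close>

definition next_tag :: "('p, 'g, 'n::finite, 'i, 'h) system \<Rightarrow> nat \<Rightarrow> tag" where
  "next_tag P t = (if t < t_fin P then CLIENTS else REWARD)"

fun valid_first :: "('p, 'g, 'n::finite, 'i, 'h) system \<Rightarrow> ('p, 'g, 'n, 'i, 'h) stx \<Rightarrow> bool" where
  "valid_first P (p, TxFirst (ClientsV C) \<pi>) \<longleftrightarrow> is_proof P CLIENTS 0 (hash P (ClientsV C)) \<pi>"
| "valid_first P _ \<longleftrightarrow> False"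

fun valid_round ::
  "('p, 'g, 'n::finite, 'i, 'h) system \<Rightarrow> nat \<Rightarrow> ('p, 'g, 'n, 'i, 'h) stx \<Rightarrow> bool" where
  "valid_round P t (p, TxRound t' K v \<pi>) \<longleftrightarrow>
     t' = t \<and> t \<le> t_fin P \<and>
     finite K \<and> (\<forall>\<rho>\<in>K. \<exists>x. is_proof P UPDATE t x \<rho>) \<and>
     m_min P \<le> card (proved_hashes P UPDATE t K) \<and>
     (if t < t_fin P then \<exists>C. v = ClientsV C else \<exists>r. v = RewardV r) \<and>
     is_proof P (next_tag P t) (Suc t) (hash P v) \<pi>"
| "valid_round P t _ \<longleftrightarrow> False"

fun valid_final :: "('p, 'g, 'n::finite, 'i, 'h) system \<Rightarrow> ('p, 'g, 'n, 'i, 'h) stx \<Rightarrow> bool" where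
  "valid_final P (p, TxFinal (RewardV r) \<pi> x \<pi>') \<longleftrightarrow>
     is_proof P REWARD (Suc (t_fin P)) (hash P (RewardV r)) \<pi> \<and> is_proof P MODEL (t_fin P) x \<pi>'"
| "valid_final P _ \<longleftrightarrow> False"

fun final_hash :: "('p, 'g, 'n::finite, 'i, 'h) stx \<Rightarrow> 'h option" where
  "final_hash (p, TxFinal v \<pi> x \<pi>') = Some x"
| "final_hash _ = None"

text \<open>The set of update proofs committed for round \<open>t\<close>: that of the first valid transaction.\<close>

definition committed ::
  "('p, 'g, 'n::finite, 'i, 'h) system \<Rightarrow> ('p, 'g, 'n, 'i, 'h) stx list \<Rightarrow> nat \<Rightarrow>
   ('p, 'h) proof_set set option" where
  "committed P L t =
     (case List.find (valid_round P t) L of Some (p, TxRound t' K v \<pi>) \<Rightarrow> Some K | _ \<Rightarrow> None)"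

definition client_set ::
  "('p, 'g, 'n::finite, 'i, 'h) system \<Rightarrow> ('p, 'g, 'n, 'i, 'h) stx list \<Rightarrow> nat \<Rightarrow> 'p set option" where
  "client_set P L t =
     (case t of
        0 \<Rightarrow> (case List.find (valid_first P) L of
               Some (p, TxFirst (ClientsV C) \<pi>) \<Rightarrow> Some C | _ \<Rightarrow> None)
      | Suc t' \<Rightarrow> (case List.find (valid_round P t') L of
               Some (p, TxRound t'' K (ClientsV C) \<pi>) \<Rightarrow> Some C | _ \<Rightarrow> None))"

definition final_model_hash ::
  "('p, 'g, 'n::finite, 'i, 'h) system \<Rightarrow> ('p, 'g, 'n, 'i, 'h) stx list \<Rightarrow> 'h option" where
  "final_model_hash P L = Option.bind (List.find (valid_final P) L) final_hash"

definition next_value ::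
  "('p, 'g, 'n::finite, 'i, 'h) system \<Rightarrow> ('p, 'g, 'n, 'i, 'h) stx list \<Rightarrow> 'p set \<Rightarrow> nat \<Rightarrow>
   ('p, 'g, 'n, 'i) data" where
  "next_value P L J t =
     (if t < t_fin P then ClientsV (select_clients P J (Suc t))
      else RewardV (reward P (map (committed P L) [0..<t_fin P])))"


section \<open>Global states\<close>

text \<open>
  \<open>sent\<close> holds all messages ever sent, \<open>inbox p\<close> those received by \<open>p\<close> in the order of reception;
  \<open>pool\<close> holds all transactions ever sent to the blockchain, \<open>ledger\<close> the ordered ones.
  The remaining components are local to correct processes: \<open>stored r\<close> is the memory of replica \<open>r\<close>,
  \<open>target k t\<close> the hash of the model that client \<open>k\<close> retrieves in round \<open>t\<close>, \<open>rnd p\<close> the current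
  round of server \<open>p\<close>, \<open>cand p t\<close> its candidate set and the value accompanying it,
  \<open>local_model p t\<close> the model it computed in round \<open>t\<close>, and \<open>obtained\<close> the result of the owner.
  Components of Byzantine processes play no role.
\<close>

record ('p, 'g, 'n, 'i, 'h) state =
  sent :: "('p, 'g, 'n, 'i, 'h) msg set"
  inbox :: "'p \<Rightarrow> ('p, 'g, 'n, 'i, 'h) msg list"
  pool :: "('p, 'g, 'n, 'i, 'h) stx set"
  ledger :: "('p, 'g, 'n, 'i, 'h) stx list"
  stored :: "'p \<Rightarrow> 'h \<Rightarrow> ('p, 'g, 'n, 'i) data option"
  target :: "'p \<Rightarrow> nat \<Rightarrow> 'h option"
  rnd :: "'p \<Rightarrow> nat"
  cand :: "'p \<Rightarrow> nat \<Rightarrow> (('p, 'h) proof_set set \<times> ('p, 'g, 'n, 'i) data) option"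
  local_model :: "'p \<Rightarrow> nat \<Rightarrow> 'n model option"
  obtained :: "'n model option"

definition initial_state :: "('p, 'g, 'n::finite, 'i, 'h) state" where
  "initial_state =
     \<lparr>sent = {}, inbox = (\<lambda>_. []), pool = {}, ledger = [], stored = (\<lambda>_ _. None),
      target = (\<lambda>_ _. None), rnd = (\<lambda>_. 0), cand = (\<lambda>_ _. None),
      local_model = (\<lambda>_ _. None), obtained = None\<rparr>"

definition to_all ::
  "'p \<Rightarrow> 'p set \<Rightarrow> ('p, 'g, 'n::finite, 'i, 'h) payload \<Rightarrow> ('p, 'g, 'n, 'i, 'h) msg set" where
  "to_all p A y = {(p, q, y) | q. q \<in> A}"

definition send ::
  "('p, 'g, 'n::finite, 'i, 'h) msg set \<Rightarrow> ('p, 'g, 'n, 'i, 'h) state \<Rightarrow> ('p, 'g, 'n, 'i, 'h) state"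
  where "send M s = s\<lparr>sent := sent s \<union> M\<rparr>"

definition submit ::
  "('p, 'g, 'n::finite, 'i, 'h) stx \<Rightarrow> ('p, 'g, 'n, 'i, 'h) state \<Rightarrow> ('p, 'g, 'n, 'i, 'h) state"
  where "submit x s = s\<lparr>pool := insert x (pool s)\<rparr>"

definition received ::
  "('p, 'g, 'n::finite, 'i, 'h) state \<Rightarrow> 'p \<Rightarrow> 'p \<Rightarrow> ('p, 'g, 'n, 'i, 'h) payload \<Rightarrow> bool" where
  "received s p q y \<longleftrightarrow> (q, p, y) \<in> set (inbox s p)"

definition holds_proof ::
  "('p, 'g, 'n::finite, 'i, 'h) system \<Rightarrow> ('p, 'g, 'n, 'i, 'h) state \<Rightarrow> 'p \<Rightarrow> tag \<Rightarrow> nat \<Rightarrow> 'h \<Rightarrow>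
   ('p, 'h) proof_set \<Rightarrow> bool" where
  "holds_proof P s p tag t x \<pi> \<longleftrightarrow>
     is_proof P tag t x \<pi> \<and> (\<forall>\<sigma>\<in>\<pi>. received s p (signer \<sigma>) (LocalProof tag t x))"

definition retrieved ::
  "('p, 'g, 'n::finite, 'i, 'h) system \<Rightarrow> ('p, 'g, 'n, 'i, 'h) state \<Rightarrow> 'p \<Rightarrow> 'h \<Rightarrow>
   ('p, 'g, 'n, 'i) data \<Rightarrow> bool" where
  "retrieved P s p x v \<longleftrightarrow> hash P v = x \<and> (\<exists>r\<in>replicas P. received s p r (Reply v))"

fun is_update :: "'p \<Rightarrow> nat \<Rightarrow> ('p, 'g, 'n::finite, 'i, 'h) msg \<Rightarrow> bool" where
  "is_update k t (k', p, UpdateMsg t' g) \<longleftrightarrow> k' = k \<and> t' = t"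
| "is_update k t _ \<longleftrightarrow> False"

definition first_update ::
  "('p, 'g, 'n::finite, 'i, 'h) state \<Rightarrow> 'p \<Rightarrow> 'p \<Rightarrow> nat \<Rightarrow> 'g option" where
  "first_update s p k t =
     (case List.find (is_update k t) (inbox s p) of
        Some (k', p', UpdateMsg t' g) \<Rightarrow> Some g | _ \<Rightarrow> None)"

definition has_update ::
  "('p, 'g, 'n::finite, 'i, 'h) system \<Rightarrow> ('p, 'g, 'n, 'i, 'h) state \<Rightarrow> 'p \<Rightarrow> nat \<Rightarrow> 'h \<Rightarrow>
   'p \<Rightarrow> 'g \<Rightarrow> bool" where
  "has_update P s p t x k g \<longleftrightarrow>
     hash P (UpdateV k t g) = x \<and>
     (received s p k (UpdateMsg t g) \<or> retrieved P s p x (UpdateV k t g))"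

fun locally_valid ::
  "('p, 'g, 'n::finite, 'i, 'h) system \<Rightarrow> ('p, 'g, 'n, 'i, 'h) state \<Rightarrow> 'p \<Rightarrow> tag \<Rightarrow> nat \<Rightarrow>
   ('p, 'g, 'n, 'i) data \<Rightarrow> bool" where
  "locally_valid P s p UPDATE t (UpdateV k t' g) \<longleftrightarrow>
     t' = t \<and> well_formatted P g \<and> (\<exists>C. client_set P (ledger s) t = Some C \<and> k \<in> C)"
| "locally_valid P s p MODEL t (ModelV w) \<longleftrightarrow>
     (\<exists>w'. local_model s p t = Some w' \<and> eps_close (gap (the_task P)) w w')"
| "locally_valid P s p CLIENTS t (ClientsV C) \<longleftrightarrow> True"
| "locally_valid P s p REWARD t (RewardV r) \<longleftrightarrow> True"
| "locally_valid P s p _ t _ \<longleftrightarrow> False"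

definition build ::
  "('p, 'g, 'n::finite, 'i, 'h) system \<Rightarrow> 'p \<Rightarrow> tag \<Rightarrow> nat \<Rightarrow> ('p, 'g, 'n, 'i) data \<Rightarrow>
   ('p, 'g, 'n, 'i, 'h) state \<Rightarrow> ('p, 'g, 'n, 'i, 'h) state" where
  "build P p tag t v s =
     (if locally_valid P s p tag t v
      then send
        ((if tag \<in> {UPDATE, MODEL} then to_all p (replicas P) (Store (hash P v) v) else {}) \<union>
         (case v of ModelV w \<Rightarrow> to_all p (servers P) (ModelMsg t w) | _ \<Rightarrow> {}) \<union>
         to_all p (servers P) (LocalProof tag t (hash P v))) s
      else s)"


section \<open>Protocol steps of correct processes\<close>

datatype ('p, 'g, 'n::finite, 'i, 'h) action =
    StartTask
  | Join 'p
  | SelectFirst 'p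
  | AnnounceFirst 'p
  | Fetch 'p nat
  | Train 'p nat
  | SignUpdate 'p nat 'p
  | Propose 'p nat
  | SubmitRound 'p nat
  | ReadUpdate 'p nat 'h
  | Aggregate 'p nat
  | SignModel 'p nat "'n model"
  | Advance 'p nat
  | SubmitFinal 'p
  | OwnerQuery
  | OwnerRead
  | StoreValue 'p 'h "('p, 'g, 'n, 'i) data"
  | Answer 'p 'p 'h

text \<open>
  Some steps carry no guard against repetition: \<open>sent\<close> and \<open>pool\<close> are sets, so executing such a step
  again has no effect. Handlers for round \<open>t\<close> remain active at a server after it has moved to a
  later round; a message about a round that a server has not reached yet waits in its inbox.
  A query stays pending at a replica until the value is stored there.
\<close>

inductive act ::
  "('p, 'g, 'n::finite, 'i, 'h) system \<Rightarrow> ('p, 'g, 'n, 'i, 'h) action \<Rightarrow>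
   ('p, 'g, 'n, 'i, 'h) state \<Rightarrow> ('p, 'g, 'n, 'i, 'h) state \<Rightarrow> bool"
  for P :: "('p, 'g, 'n::finite, 'i, 'h) system"
where
  start_task:
    "\<lbrakk>v = ModelV (initial_model P);
      s' = submit (owner P, TxStart (hash P v) (the_task P))
             (send (to_all (owner P) (replicas P) (Store (hash P v) v)) s)\<rbrakk>
     \<Longrightarrow> act P StartTask s s'"
| join:
    "\<lbrakk>k \<in> clients P - byz P; started P (ledger s)\<rbrakk>
     \<Longrightarrow> act P (Join k) s (submit (k, TxJoin) s)"
| select_first:
    "\<lbrakk>p \<in> servers P - byz P; enrolled P (ledger s) = Some J\<rbrakk>
     \<Longrightarrow> act P (SelectFirst p) s (build P p CLIENTS 0 (ClientsV (select_clients P J 0)) s)"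
| announce_first:
    "\<lbrakk>p \<in> servers P - byz P; enrolled P (ledger s) = Some J;
      v = ClientsV (select_clients P J 0);
      holds_proof P s p CLIENTS 0 (hash P v) \<pi>;
      \<nexists>\<rho>. (p, TxFirst v \<rho>) \<in> pool s\<rbrakk>
     \<Longrightarrow> act P (AnnounceFirst p) s (submit (p, TxFirst v \<pi>) s)"

| fetch_initial:
    "\<lbrakk>k \<in> clients P - byz P; client_set P (ledger s) 0 = Some C; k \<in> C;
      target s k 0 = None;
      (owner P, TxStart x tk) \<in> set (ledger s);
      s' = send (to_all k (replicas P) (Query x))
             (s\<lparr>target := (target s)(k := (target s k)(0 := Some x))\<rparr>)\<rbrakk>
     \<Longrightarrow> act P (Fetch k 0) s s'"
| fetch:
    "\<lbrakk>k \<in> clients P - byz P; client_set P (ledger s) (Suc t) = Some C; k \<in> C;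
      target s k (Suc t) = None;
      q \<in> servers P; received s k q (ModelProof t x \<pi>); is_proof P MODEL t x \<pi>;
      s' = send (to_all k (replicas P) (Query x))
             (s\<lparr>target := (target s)(k := (target s k)(Suc t := Some x))\<rparr>)\<rbrakk>
     \<Longrightarrow> act P (Fetch k (Suc t)) s s'"
| train:
    "\<lbrakk>k \<in> clients P - byz P; target s k t = Some x; retrieved P s k x (ModelV w)\<rbrakk>
     \<Longrightarrow> act P (Train k t) s (send (to_all k (servers P) (UpdateMsg t (train P k t w))) s)"

| sign_update:
    "\<lbrakk>p \<in> servers P - byz P; t \<le> rnd s p; t \<le> t_fin P; first_update s p k t = Some g;
      locally_valid P s p UPDATE t (UpdateV k t g)\<rbrakk>
     \<Longrightarrow> act P (SignUpdate p t k) s (build P p UPDATE t (UpdateV k t g) s)"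
| propose:
    "\<lbrakk>p \<in> servers P - byz P; t \<le> rnd s p; t \<le> t_fin P; cand s p t = None;
      enrolled P (ledger s) = Some J;
      X = {x. \<exists>\<pi>. holds_proof P s p UPDATE t x \<pi>};
      m_min P \<le> card X;
      \<forall>x\<in>X. holds_proof P s p UPDATE t x (F x);
      v = next_value P (ledger s) J t;
      s' = build P p (next_tag P t) (Suc t) v
             (s\<lparr>cand := (cand s)(p := (cand s p)(t := Some (F ` X, v)))\<rparr>)\<rbrakk>
     \<Longrightarrow> act P (Propose p t) s s'"
| submit_round:
    "\<lbrakk>p \<in> servers P - byz P; cand s p t = Some (K, v);
      holds_proof P s p (next_tag P t) (Suc t) (hash P v) \<pi>;
      \<nexists>\<rho>. (p, TxRound t K v \<rho>) \<in> pool s\<rbrakk>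
     \<Longrightarrow> act P (SubmitRound p t) s (submit (p, TxRound t K v \<pi>) s)"
| read_update:
    "\<lbrakk>p \<in> servers P - byz P; t \<le> rnd s p; committed P (ledger s) t = Some K;
      x \<in> proved_hashes P UPDATE t K; \<nexists>k g. has_update P s p t x k g\<rbrakk>
     \<Longrightarrow> act P (ReadUpdate p t x) s (send (to_all p (replicas P) (Query x)) s)"
| aggregate:
    "\<lbrakk>p \<in> servers P - byz P; t \<le> rnd s p; local_model s p t = None;
      committed P (ledger s) t = Some K;
      X = proved_hashes P UPDATE t K;
      \<forall>x\<in>X. \<exists>k g. has_update P s p t x k g;
      w = aggregate P p t {(k, g). \<exists>x\<in>X. has_update P s p t x k g};
      s' = build P p MODEL t (ModelV w)
             (s\<lparr>local_model := (local_model s)(p := (local_model s p)(t := Some w))\<rparr>)\<rbrakk>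
     \<Longrightarrow> act P (Aggregate p t) s s'"
| sign_model:
    "\<lbrakk>p \<in> servers P - byz P; q \<in> servers P; received s p q (ModelMsg t w);
      locally_valid P s p MODEL t (ModelV w);
      s' = send (to_all p (replicas P) (Store (hash P (ModelV w)) (ModelV w)) \<union>
                 to_all p (servers P) (LocalProof MODEL t (hash P (ModelV w)))) s\<rbrakk>
     \<Longrightarrow> act P (SignModel p t w) s s'"
| advance:
    "\<lbrakk>p \<in> servers P - byz P; rnd s p = t; t \<le> t_fin P; holds_proof P s p MODEL t x \<pi>;
      s' = send (to_all p (clients P) (ModelProof t x \<pi>))
             (s\<lparr>rnd := (rnd s)(p := Suc t)\<rparr>)\<rbrakk>
     \<Longrightarrow> act P (Advance p t) s s'"
| submit_final:
    "\<lbrakk>p \<in> servers P - byz P; cand s p (t_fin P) = Some (K, v);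
      holds_proof P s p REWARD (Suc (t_fin P)) (hash P v) \<pi>;
      holds_proof P s p MODEL (t_fin P) x \<pi>';
      \<nexists>u \<rho> y \<rho>'. (p, TxFinal u \<rho> y \<rho>') \<in> pool s\<rbrakk>
     \<Longrightarrow> act P (SubmitFinal p) s (submit (p, TxFinal v \<pi> x \<pi>') s)"

| owner_query:
    "final_model_hash P (ledger s) = Some x
     \<Longrightarrow> act P OwnerQuery s (send (to_all (owner P) (replicas P) (Query x)) s)"
| owner_read:
    "\<lbrakk>final_model_hash P (ledger s) = Some x; retrieved P s (owner P) x (ModelV w)\<rbrakk>
     \<Longrightarrow> act P OwnerRead s (s\<lparr>obtained := Some w\<rparr>)"

| store_value:
    "\<lbrakk>r \<in> replicas P - byz P; received s r q (Store x v); hash P v = x\<rbrakk>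
     \<Longrightarrow> act P (StoreValue r x v) s
           (s\<lparr>stored := (stored s)(r := (stored s r)(x := Some v))\<rparr>)"
| answer:
    "\<lbrakk>r \<in> replicas P - byz P; received s r q (Query x); stored s r x = Some v\<rbrakk>
     \<Longrightarrow> act P (Answer r q x) s (send {(r, q, Reply v)} s)"


section \<open>Byzantine steps and the environment\<close>

fun payload_sigs :: "('p, 'g, 'n::finite, 'i, 'h) payload \<Rightarrow> ('p, 'h) sig set" where
  "payload_sigs (ModelProof t x \<pi>) = \<pi>"
| "payload_sigs _ = {}"

fun tx_sigs :: "('p, 'g, 'n::finite, 'i, 'h) tx \<Rightarrow> ('p, 'h) sig set" where
  "tx_sigs (TxFirst v \<pi>) = \<pi>"
| "tx_sigs (TxRound t K v \<pi>) = \<Union>K \<union> \<pi>"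
| "tx_sigs (TxFinal v \<pi> x \<pi>') = \<pi> \<union> \<pi>'"
| "tx_sigs _ = {}"

text \<open>
  A signature on a hash by a correct process can be used by others only once the signer has issued
  it, and nobody can send under the name of a correct process; Byzantine processes share all their
  signatures. The client signature inside an \<open>UpdateV\<close> is not protected, which only strengthens the
  adversary: an update counts only if received from the client itself or through its hash.
\<close>

fun issued ::
  "('p, 'g, 'n::finite, 'i, 'h) system \<Rightarrow> ('p, 'g, 'n, 'i, 'h) state \<Rightarrow> ('p, 'h) sig \<Rightarrow> bool" where
  "issued P s (Sig q tag t x) \<longleftrightarrow> q \<in> byz P \<or> (\<exists>r. (q, r, LocalProof tag t x) \<in> sent s)"

inductive env_step ::
  "('p, 'g, 'n::finite, 'i, 'h) system \<Rightarrow> ('p, 'g, 'n, 'i, 'h) state \<Rightarrow>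
   ('p, 'g, 'n, 'i, 'h) state \<Rightarrow> bool"
  for P :: "('p, 'g, 'n::finite, 'i, 'h) system"
where
  byz_send:
    "\<lbrakk>b \<in> byz P; \<forall>\<sigma>\<in>payload_sigs y. issued P s \<sigma>\<rbrakk> \<Longrightarrow> env_step P s (send {(b, q, y)} s)"
| byz_submit:
    "\<lbrakk>b \<in> byz P; \<forall>\<sigma>\<in>tx_sigs x. issued P s \<sigma>\<rbrakk> \<Longrightarrow> env_step P s (submit (b, x) s)"
| deliver:
    "\<lbrakk>(p, q, y) \<in> sent s; (p, q, y) \<notin> set (inbox s q)\<rbrakk>
     \<Longrightarrow> env_step P s (s\<lparr>inbox := (inbox s)(q := inbox s q @ [(p, q, y)])\<rparr>)"
| order:
    "\<lbrakk>x \<in> pool s; x \<notin> set (ledger s)\<rbrakk> \<Longrightarrow> env_step P s (s\<lparr>ledger := ledger s @ [x]\<rparr>)"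
| stutter:
    "env_step P s s"


section \<open>Executions\<close>

text \<open>
  Setting up the task and joining it are voluntary; every other protocol step that remains enabled
  is eventually taken.
\<close>

fun voluntary :: "('p, 'g, 'n::finite, 'i, 'h) action \<Rightarrow> bool" where
  "voluntary StartTask \<longleftrightarrow> True"
| "voluntary (Join k) \<longleftrightarrow> True"
| "voluntary _ \<longleftrightarrow> False"

definition fair ::
  "('p, 'g, 'n::finite, 'i, 'h) system \<Rightarrow> (nat \<Rightarrow> ('p, 'g, 'n, 'i, 'h) state) \<Rightarrow> bool" where
  "fair P s \<longleftrightarrow>
     (\<forall>i p q y. p \<notin> byz P \<longrightarrow> q \<notin> byz P \<longrightarrow> (p, q, y) \<in> sent (s i) \<longrightarrow>
        (\<exists>j. (p, q, y) \<in> set (inbox (s j) q))) \<and>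
     (\<forall>i p x. p \<notin> byz P \<longrightarrow> (p, x) \<in> pool (s i) \<longrightarrow> (\<exists>j. (p, x) \<in> set (ledger (s j)))) \<and>
     (\<forall>i a. \<not> voluntary a \<longrightarrow> (\<forall>j\<ge>i. \<exists>s'. act P a (s j) s') \<longrightarrow>
        (\<exists>j\<ge>i. act P a (s j) (s (Suc j))))"

definition execution ::
  "('p, 'g, 'n::finite, 'i, 'h) system \<Rightarrow> (nat \<Rightarrow> ('p, 'g, 'n, 'i, 'h) state) \<Rightarrow> bool" where
  "execution P s \<longleftrightarrow>
     s 0 = initial_state \<and>
     (\<forall>i. (\<exists>a. act P a (s i) (s (Suc i))) \<or> env_step P (s i) (s (Suc i))) \<and>
     fair P s"

definition task_set_up ::
  "('p, 'g, 'n::finite, 'i, 'h) system \<Rightarrow> (nat \<Rightarrow> ('p, 'g, 'n, 'i, 'h) state) \<Rightarrow> nat \<Rightarrow> bool" where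
  "task_set_up P s i \<longleftrightarrow> act P StartTask (s i) (s (Suc i))"

definition models_close ::
  "('p, 'g, 'n::finite, 'i, 'h) system \<Rightarrow> (nat \<Rightarrow> ('p, 'g, 'n, 'i, 'h) state) \<Rightarrow> bool" where
  "models_close P s \<longleftrightarrow>
     (\<forall>i t. \<forall>p \<in> servers P - byz P. \<forall>q \<in> servers P - byz P. \<forall>w w'.
        local_model (s i) p t = Some w \<longrightarrow> local_model (s i) q t = Some w' \<longrightarrow>
        eps_close (gap (the_task P)) w w')"

definition clients_suffice ::
  "('p, 'g, 'n::finite, 'i, 'h) system \<Rightarrow> (nat \<Rightarrow> ('p, 'g, 'n, 'i, 'h) state) \<Rightarrow> bool" where
  "clients_suffice P s \<longleftrightarrow>
     ((\<exists>i. task_set_up P s i) \<longrightarrow> (\<exists>i. enough P (ledger (s i)))) \<and>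
     (\<forall>i J t. enrolled P (ledger (s i)) = Some J \<longrightarrow> t \<le> t_fin P \<longrightarrow>
        2 * card (select_clients P J t \<inter> byz P) < card (select_clients P J t) \<and>
        m_min P \<le> card (select_clients P J t - byz P))"

text \<open>
  The owner has read \<open>w\<close> from the storage, and \<open>w\<close> is the model of the last round whose hash and
  proof are in a valid final transaction.
\<close>

definition obtains_trained_model ::
  "('p, 'g, 'n::finite, 'i, 'h) system \<Rightarrow> ('p, 'g, 'n, 'i, 'h) state \<Rightarrow> 'n model \<Rightarrow> bool" where
  "obtains_trained_model P s w \<longleftrightarrow>
     obtained s = Some w \<and>
     (\<exists>x\<in>set (ledger s). valid_final P x \<and> final_hash x = Some (hash P (ModelV w)))"

end

theory Submission
  imports Defs "HOL-Library.Sublist"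
begin

text \<open>
  Every state component only grows along an execution, so a fact
  about how an item came into being, checked at the step that created it, holds ever after. In a
  proof with \<open>f_s + 1\<close> signers one signer is correct; hence every proved hash of an update or model
  belongs to a value that a correct server has sent to all replicas, one of which is correct, and
  every proved client set is the output of the common computation.

  For liveness, the guards of the relevant steps are stable, so fairness turns eventual enabledness
  into eventual execution. By induction on the round, all correct servers enter it with the same
  client set; the correct clients of that set produce the same updates at all correct servers, the
  \<open>f_s + 1\<close> correct servers prove them, one of their transactions commits a set of updates, and
  closeness of the aggregated models lets them jointly sign the model of any one of them.
\<close>


section \<open>Single steps\<close>

text \<open>The ledger fixes the first valid transaction of each kind, and a Byzantine server may
  win that race. Nothing on-chain can therefore be attributed to a correct author: arguments about
  ledger contents go through the signatures inside a transaction, whoever submitted it. Correct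
  servers need not agree on candidate sets, and several model hashes may be proved in one round, so
  clients may train on different models. Where \<open>f_s + 1\<close> correct signatures must meet
  on one hash, two equalities have to be shown: the next client set or rewarding information is a
  function of settled ledger contents, and a correct client's update is unique because its target is
  written once and the hash is injective. Fairness is weak: it concerns actions that stay enabled
  forever, whereas many guards are switched off by the very effect that is wanted. Hence goals are
  stable predicates, and enabledness is required only as long as the goal fails. The count
  \<open>f_s + 1\<close> works in both directions: it exceeds the number of Byzantine servers, and
  at least that many of the \<open>2 * f_s + 1\<close> servers are correct.\<close>

lemma to_all_iff [simp]: "(p', q, y') \<in> to_all p A y \<longleftrightarrow> p' = p \<and> q \<in> A \<and> y' = y"
  by (auto simp: to_all_def)

lemma send_simps [simp]:
  "sent (send M s) = sent s \<union> M" "inbox (send M s) = inbox s" "pool (send M s) = pool s"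
  "ledger (send M s) = ledger s" "stored (send M s) = stored s" "target (send M s) = target s"
  "rnd (send M s) = rnd s" "cand (send M s) = cand s" "local_model (send M s) = local_model s"
  "obtained (send M s) = obtained s"
  by (simp_all add: send_def)

lemma submit_simps [simp]:
  "sent (submit x s) = sent s" "inbox (submit x s) = inbox s" "pool (submit x s) = insert x (pool s)"
  "ledger (submit x s) = ledger s" "stored (submit x s) = stored s"
  "target (submit x s) = target s" "rnd (submit x s) = rnd s" "cand (submit x s) = cand s"
  "local_model (submit x s) = local_model s"
  by (simp_all add: submit_def)

lemma build_simps [simp]:
  "inbox (build P p tag t v s) = inbox s" "pool (build P p tag t v s) = pool s"
  "ledger (build P p tag t v s) = ledger s" "stored (build P p tag t v s) = stored s"
  "target (build P p tag t v s) = target s" "rnd (build P p tag t v s) = rnd s"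
  "cand (build P p tag t v s) = cand s" "local_model (build P p tag t v s) = local_model s"
  by (simp_all add: build_def)

lemma sent_build:
  "sent (build P p tag t v s) = sent s \<union>
     (if locally_valid P s p tag t v then
        (if tag \<in> {UPDATE, MODEL} then to_all p (replicas P) (Store (hash P v) v) else {}) \<union>
        (case v of ModelV w \<Rightarrow> to_all p (servers P) (ModelMsg t w) | _ \<Rightarrow> {}) \<union>
        to_all p (servers P) (LocalProof tag t (hash P v))
      else {})"
  by (simp add: build_def)

section \<open>Growth of the state under a step\<close>

definition step ::
  "('p, 'g, 'n::finite, 'i, 'h) system \<Rightarrow> ('p, 'g, 'n, 'i, 'h) state \<Rightarrow>
   ('p, 'g, 'n, 'i, 'h) state \<Rightarrow> bool" where
  "step P s s' \<longleftrightarrow> (\<exists>a. act P a s s') \<or> env_step P s s'"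

lemma step_cases [consumes 1, case_names act env]:
  assumes "step P s s'"
  obtains a where "act P a s s'" | "env_step P s s'"
  using assms by (auto simp: step_def)

definition extends ::
  "('p, 'g, 'n::finite, 'i, 'h) state \<Rightarrow> ('p, 'g, 'n, 'i, 'h) state \<Rightarrow> bool" where
  "extends s s' \<longleftrightarrow>
     sent s \<subseteq> sent s' \<and> (\<forall>p. prefix (inbox s p) (inbox s' p)) \<and>
     pool s \<subseteq> pool s' \<and> prefix (ledger s) (ledger s') \<and>
     (\<forall>r x. stored s r x \<noteq> None \<longrightarrow> stored s' r x \<noteq> None) \<and>
     (\<forall>k. target s k \<subseteq>\<^sub>m target s' k) \<and> (\<forall>p. rnd s p \<le> rnd s' p) \<and>
     (\<forall>p. cand s p \<subseteq>\<^sub>m cand s' p) \<and> (\<forall>p. local_model s p \<subseteq>\<^sub>m local_model s' p)"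

lemma map_le_Some: "m \<subseteq>\<^sub>m m' \<Longrightarrow> m x = Some y \<Longrightarrow> m' x = Some y"
  by (metis domI map_le_def)

lemma extends_refl: "extends s s"
  by (simp add: extends_def)

lemma extends_trans: "extends s s' \<Longrightarrow> extends s' s'' \<Longrightarrow> extends s s''"
  unfolding extends_def
  by (intro conjI allI; meson map_le_trans order_trans prefix_order.trans)

lemma step_extends:
  assumes "step P s s'"
  shows "extends s s'"
  using assms
proof (cases rule: step_cases)
  case (act a)
  then show ?thesis
    by (cases rule: act.cases) (auto simp: extends_def sent_build map_le_def, metis gr0I option.distinct(1))
next
  case env
  then show ?thesis
    by (cases rule: env_step.cases) (auto simp: extends_def)
qed

section \<open>What a single step can newly create\<close>

lemma step_inbox:
  assumes "step P s s'" "m \<in> set (inbox s' p)" "m \<notin> set (inbox s p)"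
  shows "m \<in> sent s \<and> fst (snd m) = p"
  using assms(1)
proof (cases rule: step_cases)
  case (act a)
  then show ?thesis
    using assms by (cases rule: act.cases) auto
next
  case env
  then show ?thesis
    using assms by (cases rule: env_step.cases) (auto split: if_splits)
qed

lemma step_ledger:
  assumes "step P s s'" "x \<in> set (ledger s')" "x \<notin> set (ledger s)"
  shows "x \<in> pool s"
  using assms(1)
proof (cases rule: step_cases)
  case (act a)
  then show ?thesis
    using assms by (cases rule: act.cases) auto
next
  case env
  then show ?thesis
    using assms by (cases rule: env_step.cases) auto
qed

lemma step_stored:
  assumes "step P s s'" "stored s' r x = Some v" "stored s r x \<noteq> Some v"
  shows "hash P v = x"
  using assms(1)
proof (cases rule: step_cases)
  case (act a)
  then show ?thesis
    using assms by (cases rule: act.cases) (auto split: if_splits)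
next
  case env
  then show ?thesis
    using assms by (cases rule: env_step.cases) auto
qed

lemma step_target:
  assumes "step P s s'" "target s' k t = Some x" "target s k t \<noteq> Some x"
  shows "(\<forall>r\<in>replicas P. (k, r, Query x) \<in> sent s') \<and>
    (case t of 0 \<Rightarrow> \<exists>tk. (owner P, TxStart x tk) \<in> set (ledger s)
     | Suc u \<Rightarrow> \<exists>q \<pi>. received s k q (ModelProof u x \<pi>) \<and> is_proof P MODEL u x \<pi>)"
  using assms(1)
proof (cases rule: step_cases)
  case (act a)
  then show ?thesis
    using assms by (cases rule: act.cases) (auto split: if_splits)
next
  case env
  then show ?thesis
    using assms by (cases rule: env_step.cases) auto
qed

lemma step_rnd:
  assumes "step P s s'" "t < rnd s' p" "\<not> t < rnd s p"
  shows "\<exists>x \<pi>. holds_proof P s p MODEL t x \<pi> \<and> (\<forall>k\<in>clients P. (p, k, ModelProof t x \<pi>) \<in> sent s')"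
  using assms(1)
proof (cases rule: step_cases)
  case (act a)
  then show ?thesis
    using assms by (cases rule: act.cases) (auto split: if_splits simp: less_Suc_eq)
next
  case env
  then show ?thesis
    using assms by (cases rule: env_step.cases) auto
qed

lemma step_cand:
  assumes "step P s s'" "cand s' p t = Some (K, v)" "cand s p t \<noteq> Some (K, v)"
  obtains J F X where "p \<in> servers P - byz P" "t \<le> rnd s p" "t \<le> t_fin P"
    "enrolled P (ledger s) = Some J" "X = {x. \<exists>\<pi>. holds_proof P s p UPDATE t x \<pi>}"
    "m_min P \<le> card X" "\<forall>x\<in>X. holds_proof P s p UPDATE t x (F x)"
    "K = F ` X" "v = next_value P (ledger s) J t"
    "\<forall>q\<in>servers P. (p, q, LocalProof (next_tag P t) (Suc t) (hash P v)) \<in> sent s'"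
  using assms(1)
proof (cases rule: step_cases)
  case (act a)
  then show ?thesis
  proof (cases rule: act.cases)
    case (propose p' t' J X F v')
    \<comment> \<open>\<open>next_value\<close> has the constructor that \<open>next_tag\<close>
      announces, and such values are locally valid in every state; so \<open>build\<close> really
      sends.\<close>
    have lv: "locally_valid P u p (next_tag P t') (Suc t') v'" for u
      using propose by (auto simp: next_tag_def next_value_def)
    have eq: "p' = p" "t' = t" "K = F ` X" "v' = v"
      using assms(2,3) propose by (auto split: if_splits)
    show ?thesis
      by (rule that[of J X F]) (use propose eq lv in \<open>auto simp: sent_build\<close>)
  qed (use assms in auto)
next
  case env
  then show ?thesis
    using assms by (cases rule: env_step.cases) auto
qed

text \<open>A server passes its own model through \<open>locally_valid\<close>, which compares the
  model with itself. With a negative coordinate in the gap this would fail, so reflexivity stays a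
  premise here; it is discharged later from \<open>models_close\<close>.\<close>

lemma step_local_model:
  assumes "step P s s'" "local_model s' p t = Some w" "local_model s p t \<noteq> Some w"
  shows "p \<in> servers P - byz P \<and> committed P (ledger s) t \<noteq> None \<and>
    (eps_close (gap (the_task P)) w w \<longrightarrow> (\<forall>q\<in>servers P. (p, q, ModelMsg t w) \<in> sent s'))"
  using assms(1)
proof (cases rule: step_cases)
  case (act a)
  then show ?thesis
    using assms by (cases rule: act.cases) (auto split: if_splits simp: sent_build)
next
  case env
  then show ?thesis
    using assms by (cases rule: env_step.cases) auto
qed

text \<open>In the \<open>MODEL\<close> case the signed model need not be the signer's own:
  \<open>sign_model\<close> signs models of others. What holds for both kinds of signing is that the
  signer has some local model of the round, which ties the signature to a committed round.\<close>

lemma step_LocalProof: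
  assumes "step P s s'" "(q, r, LocalProof tag t x) \<in> sent s'" "(q, r, LocalProof tag t x) \<notin> sent s"
    and "q \<notin> byz P"
  shows "case tag of
      UPDATE \<Rightarrow> \<exists>k g. x = hash P (UpdateV k t g) \<and>
        (\<forall>r\<in>replicas P. (q, r, Store x (UpdateV k t g)) \<in> sent s')
    | MODEL \<Rightarrow> q \<in> servers P \<and> local_model s' q t \<noteq> None \<and>
        (\<exists>w. x = hash P (ModelV w) \<and> (\<forall>r\<in>replicas P. (q, r, Store x (ModelV w)) \<in> sent s'))
    | CLIENTS \<Rightarrow> \<exists>J. enrolled P (ledger s) = Some J \<and> x = hash P (ClientsV (select_clients P J t))
    | REWARD \<Rightarrow> True"
  using assms(1)
proof (cases rule: step_cases)
  case (act a)
  then show ?thesis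
    using assms(2,3)
    by (cases rule: act.cases)
      (auto simp: sent_build next_tag_def next_value_def split: if_splits tag.splits)
next
  case env
  then show ?thesis
    using assms by (cases rule: env_step.cases) auto
qed

lemma step_UpdateMsg:
  assumes "step P s s'" "(k, q, UpdateMsg t g) \<in> sent s'" "(k, q, UpdateMsg t g) \<notin> sent s"
    and "k \<notin> byz P"
  shows "\<exists>w. target s k t = Some (hash P (ModelV w)) \<and> g = train P k t w"
  using assms(1)
proof (cases rule: step_cases)
  case (act a)
  then show ?thesis
    using assms(2,3)
    by (cases rule: act.cases)
      (auto simp: sent_build next_value_def retrieved_def split: if_splits)
next
  case env
  then show ?thesis
    using assms by (cases rule: env_step.cases) auto
qed

lemma step_ModelProof:
  assumes "step P s s'" "(p, q, ModelProof t x \<pi>) \<in> sent s'" "(p, q, ModelProof t x \<pi>) \<notin> sent s"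
  shows "holds_proof P s p MODEL t x \<pi> \<or> (\<forall>\<sigma>\<in>\<pi>. issued P s \<sigma>)"
  using assms(1)
proof (cases rule: step_cases)
  case (act a)
  then show ?thesis
    using assms(2,3)
    by (cases rule: act.cases)
      (auto simp: sent_build next_value_def split: if_splits)
next
  case env
  then show ?thesis
    using assms by (cases rule: env_step.cases) auto
qed

lemma step_pool:
  assumes "step P s s'" "(p, x) \<in> pool s'" "(p, x) \<notin> pool s"
  shows "(p \<in> byz P \<and> (\<forall>\<sigma>\<in>tx_sigs x. issued P s \<sigma>)) \<or>
    (case x of
       TxStart y tk \<Rightarrow> p = owner P \<and> y = hash P (ModelV (initial_model P))
     | TxJoin \<Rightarrow> True
     | TxFirst v \<pi> \<Rightarrow> (\<exists>C. v = ClientsV C) \<and> holds_proof P s p CLIENTS 0 (hash P v) \<pi>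
     | TxRound t K v \<pi> \<Rightarrow> p \<in> servers P - byz P \<and> cand s p t = Some (K, v) \<and>
         holds_proof P s p (next_tag P t) (Suc t) (hash P v) \<pi>
     | TxFinal v \<pi> y \<pi>' \<Rightarrow> p \<in> servers P - byz P \<and> (\<exists>K. cand s p (t_fin P) = Some (K, v)) \<and>
         holds_proof P s p REWARD (Suc (t_fin P)) (hash P v) \<pi> \<and>
         holds_proof P s p MODEL (t_fin P) y \<pi>')"
  using assms(1)
proof (cases rule: step_cases)
  case (act a)
  then show ?thesis
    using assms(2,3) by (cases rule: act.cases) auto
next
  case env
  then show ?thesis
    using assms by (cases rule: env_step.cases) auto
qed


section \<open>Ledger and proofs\<close>

lemma find_append: "List.find Q (xs @ ys) = (case List.find Q xs of None \<Rightarrow> List.find Q ys | r \<Rightarrow> r)"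
  by (induction xs) auto

text \<open>Appending cannot change the first hit. This is why committed sets, client sets and the
  final hash never change once they are defined.\<close>

lemma find_prefix: "prefix L L' \<Longrightarrow> List.find Q L = Some x \<Longrightarrow> List.find Q L' = Some x"
  by (auto simp: prefix_def find_append)

lemma valid_round_cases:
  assumes "valid_round P t x"
  obtains p t' K v \<pi> where "x = (p, TxRound t' K v \<pi>)"
  using assms by (induction P t x rule: valid_round.induct) auto

lemma valid_first_cases:
  assumes "valid_first P x"
  obtains p C \<pi> where "x = (p, TxFirst (ClientsV C) \<pi>)"
  using assms by (induction P x rule: valid_first.induct) auto

lemma valid_final_cases:
  assumes "valid_final P x"
  obtains p r \<pi> y \<pi>' where "x = (p, TxFinal (RewardV r) \<pi> y \<pi>')"
  using assms by (induction P x rule: valid_final.induct) auto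

lemma find_SomeD: "List.find Q L = Some x \<Longrightarrow> x \<in> set L \<and> Q x"
  by (auto simp: find_Some_iff)

lemma find_ex: "x \<in> set L \<Longrightarrow> Q x \<Longrightarrow> \<exists>y. List.find Q L = Some y \<and> y \<in> set L \<and> Q y"
  by (metis find_None_iff find_SomeD not_None_eq)

lemma find_valid_round:
  assumes "List.find (valid_round P t) L = Some x"
  obtains p K v \<pi> where "x = (p, TxRound t K v \<pi>)"
proof -
  have "valid_round P t x"
    using find_SomeD[OF assms] by blast
  moreover from this obtain p t' K v \<pi> where "x = (p, TxRound t' K v \<pi>)"
    using valid_round_cases by metis
  ultimately show ?thesis
    using that by simp
qed

lemma find_valid_first:
  assumes "List.find (valid_first P) L = Some x"
  obtains p C \<pi> where "x = (p, TxFirst (ClientsV C) \<pi>)"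
  using find_SomeD[OF assms] valid_first_cases by metis

lemma find_valid_final:
  assumes "List.find (valid_final P) L = Some x"
  obtains p r \<pi> y \<pi>' where "x = (p, TxFinal (RewardV r) \<pi> y \<pi>')"
  using find_SomeD[OF assms] valid_final_cases by metis

text \<open>The catch-all branch of the definition is unreachable for a transaction that has been
  found, since passing the validity test forces the shape \<open>TxRound\<close>.\<close>

lemma committed_Some_iff:
  "committed P L t = Some K \<longleftrightarrow> (\<exists>p v \<pi>. List.find (valid_round P t) L = Some (p, TxRound t K v \<pi>))"
proof (cases "List.find (valid_round P t) L")
  case (Some x)
  then show ?thesis
    by (rule find_valid_round) (use Some in \<open>auto simp: committed_def\<close>)
qed (simp add: committed_def)

lemma client_set_0_iff:
  "client_set P L 0 = Some C \<longleftrightarrow> (\<exists>p \<pi>. List.find (valid_first P) L = Some (p, TxFirst (ClientsV C) \<pi>))"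
proof (cases "List.find (valid_first P) L")
  case (Some x)
  then show ?thesis
    by (rule find_valid_first) (use Some in \<open>auto simp: client_set_def\<close>)
qed (simp add: client_set_def)

lemma client_set_Suc_iff:
  "client_set P L (Suc t) = Some C \<longleftrightarrow>
    (\<exists>p K \<pi>. List.find (valid_round P t) L = Some (p, TxRound t K (ClientsV C) \<pi>))"
proof (cases "List.find (valid_round P t) L")
  case (Some x)
  then show ?thesis
    by (rule find_valid_round) (use Some in \<open>auto simp: client_set_def split: data.splits\<close>)
qed (simp add: client_set_def)

lemma final_model_hash_iff:
  "final_model_hash P L = Some y \<longleftrightarrow>
    (\<exists>p r \<pi> \<pi>'. List.find (valid_final P) L = Some (p, TxFinal (RewardV r) \<pi> y \<pi>'))"
proof (cases "List.find (valid_final P) L")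
  case (Some x)
  then show ?thesis
    by (rule find_valid_final) (use Some in \<open>auto simp: final_model_hash_def\<close>)
qed (simp add: final_model_hash_def)

lemma committed_prefix: "prefix L L' \<Longrightarrow> committed P L t = Some K \<Longrightarrow> committed P L' t = Some K"
  unfolding committed_Some_iff by (blast intro: find_prefix)

lemma final_model_hash_prefix:
  "prefix L L' \<Longrightarrow> final_model_hash P L = Some y \<Longrightarrow> final_model_hash P L' = Some y"
  unfolding final_model_hash_iff by (blast intro: find_prefix)

text \<open>The least \<open>n\<close> with \<open>enough\<close> is at most
  \<open>length L\<close>, and up to that length \<open>L\<close> and \<open>L'\<close> have the
  same prefixes; the minimum cannot move.\<close>

lemma enrolled_prefix:
  assumes "prefix L L'" "enrolled P L = Some J"
  shows "enrolled P L' = Some J"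
proof -
  obtain M where L': "L' = L @ M"
    using assms(1) by (auto simp: prefix_def)
  define n where "n = (LEAST n. enough P (take n L))"
  obtain m where m: "m \<le> length L" "enough P (take m L)" and J: "J = joined P (take n L)"
    using assms(2) by (auto simp: enrolled_def n_def split: if_splits)
  have n: "enough P (take n L)" "n \<le> length L"
    using m Least_le[of "\<lambda>n. enough P (take n L)" m] LeastI[of "\<lambda>n. enough P (take n L)" m]
    by (auto simp: n_def)
  have "(LEAST n. enough P (take n L')) = n"
  proof (rule Least_equality)
    show "enough P (take n L')"
      using n by (simp add: L')
    fix k assume k: "enough P (take k L')"
    show "n \<le> k"
    proof (rule ccontr)
      assume "\<not> n \<le> k"
      then have "enough P (take k L)"
        using k n(2) by (simp add: L')
      then show False
        using \<open>\<not> n \<le> k\<close> Least_le[of "\<lambda>n. enough P (take n L)" k] by (simp add: n_def)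
    qed
  qed
  moreover have "\<exists>n\<le>length L'. enough P (take n L')"
    using n by (intro exI[of _ n]) (simp add: L')
  ultimately show ?thesis
    using n J by (simp add: enrolled_def L')
qed

lemma enough_enrolled:
  assumes "enough P L"
  obtains J where "enrolled P L = Some J"
proof -
  have "\<exists>n\<le>length L. enough P (take n L)"
    using assms by (intro exI[of _ "length L"]) simp
  then show ?thesis
    using that by (simp add: enrolled_def)
qed

lemma enrolled_subset_clients: "enrolled P L = Some J \<Longrightarrow> J \<subseteq> clients P"
  by (auto simp: enrolled_def joined_def split: if_splits)

section \<open>Proofs as sets of signatures; finiteness and monotonicity\<close>

lemma is_proof_nonempty: "is_proof P tag t x \<pi> \<Longrightarrow> \<pi> \<noteq> {}"
  by (auto simp: is_proof_def)

lemma is_proof_hash_unique: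
  assumes "is_proof P tag t x \<pi>" "is_proof P tag t y \<pi>"
  shows "x = y"
proof -
  obtain \<sigma> where "\<sigma> \<in> \<pi>"
    using is_proof_nonempty[OF assms(1)] by blast
  then show ?thesis
    using assms by (auto simp: is_proof_def)
qed

text \<open>A proof is nonempty and its signatures carry the hash, so each member of
  \<open>K\<close> proves at most one hash. Finiteness makes cardinality bounds meaningful and lets
  a server wait for all committed updates.\<close>

lemma finite_proved_hashes:
  assumes "finite K"
  shows "finite (proved_hashes P tag t K)"
proof (rule finite_subset)
  show "proved_hashes P tag t K \<subseteq> (\<lambda>\<pi>. THE x. is_proof P tag t x \<pi>) ` K"
    unfolding proved_hashes_def by (auto intro!: image_eqI the_equality[symmetric] dest: is_proof_hash_unique)
  show "finite \<dots>"
    using assms by simp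
qed

lemma received_mono: "extends s s' \<Longrightarrow> received s p q y \<Longrightarrow> received s' p q y"
  unfolding received_def extends_def using set_mono_prefix by fast

lemma retrieved_mono: "extends s s' \<Longrightarrow> retrieved P s p x v \<Longrightarrow> retrieved P s' p x v"
  by (auto simp: retrieved_def dest: received_mono)

lemma has_update_mono: "extends s s' \<Longrightarrow> has_update P s p t x k g \<Longrightarrow> has_update P s' p t x k g"
  by (auto simp: has_update_def dest: received_mono retrieved_mono)

lemma issued_mono: "extends s s' \<Longrightarrow> issued P s \<sigma> \<Longrightarrow> issued P s' \<sigma>"
  by (cases \<sigma>) (auto simp: extends_def)

text \<open>Every held hash occurs in a \<open>LocalProof\<close> message of the inbox, which is a
  finite list. Without finiteness \<open>card\<close> would be 0 and say nothing about the number of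
  proved updates.\<close>

lemma finite_held_hashes: "finite {x. \<exists>\<pi>. holds_proof P s p tag t x \<pi>}"
proof (rule finite_subset)
  let ?h = "\<lambda>m. case m of (q, p, LocalProof tag t x) \<Rightarrow> x | _ \<Rightarrow> undefined"
  show "{x. \<exists>\<pi>. holds_proof P s p tag t x \<pi>} \<subseteq> ?h ` set (inbox s p)"
  proof safe
    fix x \<pi> assume h: "holds_proof P s p tag t x \<pi>"
    then obtain \<sigma> where "\<sigma> \<in> \<pi>"
      using is_proof_nonempty by (fastforce simp: holds_proof_def)
    then have "(signer \<sigma>, p, LocalProof tag t x) \<in> set (inbox s p)"
      using h by (simp add: holds_proof_def received_def)
    then show "x \<in> ?h ` set (inbox s p)"
      by (rule rev_image_eqI) simp
  qed
qed simp


section \<open>Safety\<close>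

locale run =
  fixes P :: "('p, 'g, 'n::finite, 'i, 'h) system"
    and s :: "nat \<Rightarrow> ('p, 'g, 'n, 'i, 'h) state"
  assumes well_formed: "well_formed P"
    and card_servers: "card (servers P) = 2 * f_s P + 1"
    and card_byz_servers: "card (servers P \<inter> byz P) \<le> f_s P"
    and card_replicas: "card (replicas P) = f_r P + 1"
    and card_byz_replicas: "card (replicas P \<inter> byz P) \<le> f_r P"
    and execution: "execution P s"
    and models_close: "models_close P s"
begin

lemma hash_eq_iff [simp]: "hash P v = hash P v' \<longleftrightarrow> v = v'"
  using well_formed by (auto simp: well_formed_def inj_eq)

lemma owner_correct [simp]: "owner P \<notin> byz P"
  using well_formed by (simp add: well_formed_def)

lemma finite_servers: "finite (servers P)"
  using card_servers card.infinite by fastforce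

lemma step: "step P (s i) (s (Suc i))"
  using execution by (simp add: execution_def step_def)

lemma extends: "i \<le> j \<Longrightarrow> extends (s i) (s j)"
  by (induction rule: dec_induct) (auto intro: extends_refl extends_trans step_extends step)

lemma initial [simp]: "s 0 = initial_state"
  using execution by (simp add: execution_def)

lemma ledger_prefix: "i \<le> j \<Longrightarrow> prefix (ledger (s i)) (ledger (s j))"
  using extends[of i j] by (auto simp: extends_def)

lemma sent_mono: "i \<le> j \<Longrightarrow> m \<in> sent (s i) \<Longrightarrow> m \<in> sent (s j)"
  using extends[of i j] by (auto simp: extends_def)

lemma pool_mono: "i \<le> j \<Longrightarrow> m \<in> pool (s i) \<Longrightarrow> m \<in> pool (s j)"
  using extends[of i j] by (auto simp: extends_def)

lemma ledger_mono: "i \<le> j \<Longrightarrow> m \<in> set (ledger (s i)) \<Longrightarrow> m \<in> set (ledger (s j))"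
  using ledger_prefix set_mono_prefix by blast

lemma inbox_mono: "i \<le> j \<Longrightarrow> m \<in> set (inbox (s i) p) \<Longrightarrow> m \<in> set (inbox (s j) p)"
  using extends[of i j] set_mono_prefix[of "inbox (s i) p" "inbox (s j) p"]
  by (auto simp: extends_def)

lemma target_mono: "i \<le> j \<Longrightarrow> target (s i) k t = Some x \<Longrightarrow> target (s j) k t = Some x"
  using extends[of i j] by (auto simp: extends_def intro: map_le_Some)

lemma cand_mono: "i \<le> j \<Longrightarrow> cand (s i) k t = Some x \<Longrightarrow> cand (s j) k t = Some x"
  using extends[of i j] by (auto simp: extends_def intro: map_le_Some)

lemma local_model_mono: "i \<le> j \<Longrightarrow> local_model (s i) k t = Some x \<Longrightarrow> local_model (s j) k t = Some x"
  using extends[of i j] by (auto simp: extends_def intro: map_le_Some)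

lemma rnd_mono: "i \<le> j \<Longrightarrow> rnd (s i) p \<le> rnd (s j) p"
  using extends[of i j] by (auto simp: extends_def)

lemma stored_mono: "i \<le> j \<Longrightarrow> stored (s i) r x \<noteq> None \<Longrightarrow> stored (s j) r x \<noteq> None"
  using extends[of i j] by (auto simp: extends_def)

lemma le_Suc_self: "j \<le> Suc j"
  by simp

lemmas sent_Suc = sent_mono[OF le_Suc_self] and pool_Suc = pool_mono[OF le_Suc_self]
  and target_Suc = target_mono[OF le_Suc_self]
  and issued_Suc = issued_mono[OF extends[OF le_Suc_self]]
  and committed_Suc = committed_prefix[OF ledger_prefix[OF le_Suc_self]]
  and enrolled_Suc = enrolled_prefix[OF ledger_prefix[OF le_Suc_self]]

lemma sent_all_Suc:
  "\<forall>r\<in>A. (q, r, y) \<in> sent (s j) \<Longrightarrow> \<forall>r\<in>A. (q, r, y) \<in> sent (s (Suc j))"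
  using sent_Suc by blast

text \<open>\<open>A\<close> is the presence of an item, \<open>B\<close> a statement about its
  origin. It suffices to check \<open>B\<close> at the step that makes \<open>A\<close> true and to
  preserve \<open>B\<close> on its own; preservation of \<open>A\<close> is nowhere
  required.\<close>

lemma invariantI:
  assumes "A (s i)" "\<not> A initial_state"
    and "\<And>j. \<not> A (s j) \<Longrightarrow> A (s (Suc j)) \<Longrightarrow> B (s (Suc j))"
    and "\<And>j. B (s j) \<Longrightarrow> B (s (Suc j))"
  shows "B (s i)"
  using assms(1)
proof (induction i)
  case 0
  then show ?case using assms(2) by simp
next
  case (Suc i)
  then show ?case using assms(3,4) by blast
qed

lemma inbox_sent:
  assumes "(q, p', y) \<in> set (inbox (s i) p)"
  shows "p' = p \<and> (q, p, y) \<in> sent (s i)"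
proof (rule invariantI[where A = "\<lambda>s. (q, p', y) \<in> set (inbox s p)" and i = i])
  fix j assume "(q, p', y) \<notin> set (inbox (s j) p)" "(q, p', y) \<in> set (inbox (s (Suc j)) p)"
  then have "(q, p', y) \<in> sent (s j)" "p' = p"
    using step_inbox[OF step[of j]] by fastforce+
  then show "p' = p \<and> (q, p, y) \<in> sent (s (Suc j))"
    using sent_Suc[of _ j] by auto
qed (use assms in \<open>auto simp: initial_state_def intro: sent_Suc\<close>)

lemma received_sent: "received (s i) p q y \<Longrightarrow> (q, p, y) \<in> sent (s i)"
  using inbox_sent by (auto simp: received_def)

lemma ledger_pool:
  assumes "x \<in> set (ledger (s i))"
  shows "x \<in> pool (s i)"
proof (rule invariantI[where A = "\<lambda>s. x \<in> set (ledger s)" and i = i])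
  fix j assume "x \<notin> set (ledger (s j))" "x \<in> set (ledger (s (Suc j)))"
  then show "x \<in> pool (s (Suc j))"
    using step_ledger[OF step[of j]] pool_Suc[of _ j] by auto
qed (use assms in \<open>auto simp: initial_state_def intro: pool_Suc\<close>)

lemma stored_hash:
  assumes "stored (s i) r x = Some v"
  shows "hash P v = x"
proof (rule invariantI[where A = "\<lambda>s. stored s r x = Some v" and i = i])
  fix j assume "stored (s j) r x \<noteq> Some v" "stored (s (Suc j)) r x = Some v"
  then show "hash P v = x"
    using step_stored[OF step[of j]] by blast
qed (use assms in \<open>auto simp: initial_state_def\<close>)

text \<open>The owner is correct, so every start transaction under its name stems from
  \<open>start_task\<close>. Clients in round 0 may pick any such transaction and still get the
  initial model.\<close>

lemma TxStart_hash:
  assumes "(owner P, TxStart x tk) \<in> pool (s i)"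
  shows "x = hash P (ModelV (initial_model P))"
proof (rule invariantI[where A = "\<lambda>s. (owner P, TxStart x tk) \<in> pool s" and i = i])
  fix j assume "(owner P, TxStart x tk) \<notin> pool (s j)" "(owner P, TxStart x tk) \<in> pool (s (Suc j))"
  then show "x = hash P (ModelV (initial_model P))"
    using step_pool[OF step[of j], of "owner P" "TxStart x tk"] by auto
qed (use assms in \<open>auto simp: initial_state_def\<close>)

lemma holds_proof_issued:
  assumes "holds_proof P (s i) p tag t x \<pi>" "\<sigma> \<in> \<pi>"
  shows "issued P (s i) \<sigma>"
proof -
  obtain q where \<sigma>: "\<sigma> = Sig q tag t x"
    using assms by (auto simp: holds_proof_def is_proof_def)
  then have "received (s i) p q (LocalProof tag t x)"
    using assms by (force simp: holds_proof_def)
  then show ?thesis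
    using \<sigma> by (auto dest: received_sent)
qed

text \<open>Pigeonhole: \<open>f_s + 1\<close> signers are not all Byzantine. The premise on
  \<open>issued\<close> excludes forging; for a correct signer it yields an actual message.\<close>

lemma correct_signer:
  assumes "is_proof P tag t x \<pi>" "\<And>\<sigma>. \<sigma> \<in> \<pi> \<Longrightarrow> issued P (s i) \<sigma>"
  obtains q r where "q \<in> servers P - byz P" "(q, r, LocalProof tag t x) \<in> sent (s i)"
proof -
  obtain Q where Q: "Q \<subseteq> servers P" "card Q = f_s P + 1" "\<pi> = (\<lambda>q. Sig q tag t x) ` Q"
    using assms(1) by (auto simp: is_proof_def)
  have "\<not> Q \<subseteq> servers P \<inter> byz P"
    using card_mono[of "servers P \<inter> byz P" Q] finite_servers card_byz_servers Q(2) by auto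
  then obtain q where "q \<in> Q" "q \<notin> byz P"
    using Q(1) by blast
  moreover from this have "issued P (s i) (Sig q tag t x)"
    using assms(2) Q(3) by blast
  ultimately show ?thesis
    using that Q(1) by auto
qed

lemma local_model_provenance:
  assumes "local_model (s i) p t = Some w"
  shows "p \<in> servers P - byz P \<and> committed P (ledger (s i)) t \<noteq> None \<and>
    (\<forall>q\<in>servers P. (p, q, ModelMsg t w) \<in> sent (s i))"
proof (rule invariantI[where A = "\<lambda>s. local_model s p t = Some w" and i = i])
  fix j assume new: "local_model (s j) p t \<noteq> Some w" "local_model (s (Suc j)) p t = Some w"
  note * = step_local_model[OF step[of j] new(2,1)]
  \<comment> \<open>\<open>models_close\<close> is applied with both servers equal to
    \<open>p\<close>, which gives reflexivity without any sign condition on the gap.\<close>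
  have "eps_close (gap (the_task P)) w w"
    using models_close new(2) * by (auto simp: models_close_def)
  then show "p \<in> servers P - byz P \<and> committed P (ledger (s (Suc j))) t \<noteq> None \<and>
    (\<forall>q\<in>servers P. (p, q, ModelMsg t w) \<in> sent (s (Suc j)))"
    using * committed_Suc[of _ j] by auto
next
  fix j assume "p \<in> servers P - byz P \<and> committed P (ledger (s j)) t \<noteq> None \<and>
    (\<forall>q\<in>servers P. (p, q, ModelMsg t w) \<in> sent (s j))"
  then show "p \<in> servers P - byz P \<and> committed P (ledger (s (Suc j))) t \<noteq> None \<and>
    (\<forall>q\<in>servers P. (p, q, ModelMsg t w) \<in> sent (s (Suc j)))"
    using committed_Suc[of _ j] sent_Suc[of _ j] by auto
qed (use assms in \<open>auto simp: initial_state_def\<close>)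

lemma LocalProof_UPDATE:
  assumes "(q, r, LocalProof UPDATE t x) \<in> sent (s i)" "q \<notin> byz P"
  shows "\<exists>k g. x = hash P (UpdateV k t g) \<and>
    (\<forall>r\<in>replicas P. (q, r, Store x (UpdateV k t g)) \<in> sent (s i))"
proof (rule invariantI[where A = "\<lambda>s. (q, r, LocalProof UPDATE t x) \<in> sent s" and i = i])
  fix j assume "(q, r, LocalProof UPDATE t x) \<notin> sent (s j)"
    "(q, r, LocalProof UPDATE t x) \<in> sent (s (Suc j))"
  then show "\<exists>k g. x = hash P (UpdateV k t g) \<and>
    (\<forall>r\<in>replicas P. (q, r, Store x (UpdateV k t g)) \<in> sent (s (Suc j)))"
    using step_LocalProof[OF step[of j]] assms(2) by fastforce
next
  fix j assume "\<exists>k g. x = hash P (UpdateV k t g) \<and>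
    (\<forall>r\<in>replicas P. (q, r, Store x (UpdateV k t g)) \<in> sent (s j))"
  then show "\<exists>k g. x = hash P (UpdateV k t g) \<and>
    (\<forall>r\<in>replicas P. (q, r, Store x (UpdateV k t g)) \<in> sent (s (Suc j)))"
    using sent_Suc[of _ j] by auto
qed (use assms in \<open>auto simp: initial_state_def\<close>)

lemma LocalProof_MODEL:
  assumes "(q, r, LocalProof MODEL t x) \<in> sent (s i)" "q \<notin> byz P"
  shows "committed P (ledger (s i)) t \<noteq> None \<and> (\<exists>w. x = hash P (ModelV w) \<and>
    (\<forall>r\<in>replicas P. (q, r, Store x (ModelV w)) \<in> sent (s i)))"
proof (rule invariantI[where A = "\<lambda>s. (q, r, LocalProof MODEL t x) \<in> sent s" and i = i])
  fix j assume "(q, r, LocalProof MODEL t x) \<notin> sent (s j)"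
    "(q, r, LocalProof MODEL t x) \<in> sent (s (Suc j))"
  then show "committed P (ledger (s (Suc j))) t \<noteq> None \<and> (\<exists>w. x = hash P (ModelV w) \<and>
    (\<forall>r\<in>replicas P. (q, r, Store x (ModelV w)) \<in> sent (s (Suc j))))"
    using step_LocalProof[OF step[of j], of q r MODEL t x] assms(2) local_model_provenance[of "Suc j" q t]
    by fastforce
next
  fix j assume "committed P (ledger (s j)) t \<noteq> None \<and> (\<exists>w. x = hash P (ModelV w) \<and>
    (\<forall>r\<in>replicas P. (q, r, Store x (ModelV w)) \<in> sent (s j)))"
  then show "committed P (ledger (s (Suc j))) t \<noteq> None \<and> (\<exists>w. x = hash P (ModelV w) \<and>
    (\<forall>r\<in>replicas P. (q, r, Store x (ModelV w)) \<in> sent (s (Suc j))))"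
    using sent_Suc[of _ j] committed_Suc[of _ j] by auto
qed (use assms in \<open>auto simp: initial_state_def\<close>)

lemma LocalProof_CLIENTS:
  assumes "(q, r, LocalProof CLIENTS t x) \<in> sent (s i)" "q \<notin> byz P"
  shows "\<exists>J. enrolled P (ledger (s i)) = Some J \<and> x = hash P (ClientsV (select_clients P J t))"
proof (rule invariantI[where A = "\<lambda>s. (q, r, LocalProof CLIENTS t x) \<in> sent s" and i = i])
  fix j assume "(q, r, LocalProof CLIENTS t x) \<notin> sent (s j)"
    "(q, r, LocalProof CLIENTS t x) \<in> sent (s (Suc j))"
  then show "\<exists>J. enrolled P (ledger (s (Suc j))) = Some J \<and>
      x = hash P (ClientsV (select_clients P J t))"
    using step_LocalProof[OF step[of j], of q r CLIENTS t x] assms(2)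
      enrolled_Suc[of _ j] by fastforce
next
  fix j assume "\<exists>J. enrolled P (ledger (s j)) = Some J \<and>
      x = hash P (ClientsV (select_clients P J t))"
  then show "\<exists>J. enrolled P (ledger (s (Suc j))) = Some J \<and>
      x = hash P (ClientsV (select_clients P J t))"
    using enrolled_Suc[of _ j] by auto
qed (use assms in \<open>auto simp: initial_state_def\<close>)

text \<open>Leaving round \<open>t\<close> takes a model proof, and its correct signer had
  aggregated committed updates. The first conjunct later fixes the rewarding information; the second
  serves the clients of the following round.\<close>

lemma rnd_provenance:
  assumes "t < rnd (s i) p"
  shows "committed P (ledger (s i)) t \<noteq> None \<and>
    (\<exists>x \<pi>. is_proof P MODEL t x \<pi> \<and> (\<forall>k\<in>clients P. (p, k, ModelProof t x \<pi>) \<in> sent (s i)))"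
proof (rule invariantI[where A = "\<lambda>s. t < rnd s p" and i = i])
  fix j assume "\<not> t < rnd (s j) p" "t < rnd (s (Suc j)) p"
  then obtain x \<pi> where *: "holds_proof P (s j) p MODEL t x \<pi>"
      "\<forall>k\<in>clients P. (p, k, ModelProof t x \<pi>) \<in> sent (s (Suc j))"
    using step_rnd[OF step[of j]] by blast
  obtain q r where "q \<in> servers P - byz P" "(q, r, LocalProof MODEL t x) \<in> sent (s j)"
    using correct_signer[of MODEL t x \<pi> j] * holds_proof_issued
    by (metis holds_proof_def)
  then have "committed P (ledger (s j)) t \<noteq> None"
    using LocalProof_MODEL by blast
  then show "committed P (ledger (s (Suc j))) t \<noteq> None \<and> (\<exists>x \<pi>. is_proof P MODEL t x \<pi> \<and>
      (\<forall>k\<in>clients P. (p, k, ModelProof t x \<pi>) \<in> sent (s (Suc j))))"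
    using * committed_Suc[of _ j] by (auto simp: holds_proof_def)
next
  fix j assume "committed P (ledger (s j)) t \<noteq> None \<and> (\<exists>x \<pi>. is_proof P MODEL t x \<pi> \<and>
      (\<forall>k\<in>clients P. (p, k, ModelProof t x \<pi>) \<in> sent (s j)))"
  then show "committed P (ledger (s (Suc j))) t \<noteq> None \<and> (\<exists>x \<pi>. is_proof P MODEL t x \<pi> \<and>
      (\<forall>k\<in>clients P. (p, k, ModelProof t x \<pi>) \<in> sent (s (Suc j))))"
    using committed_Suc[of P j t] sent_all_Suc[of "clients P" p _ j] by fastforce
qed (use assms in \<open>auto simp: initial_state_def\<close>)

text \<open>
  In the last round, the value of a candidate set is the same at all later times because the
  committed sets of all earlier rounds, on which it depends, are already on the ledger.
\<close>

definition good_cand ::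
  "('p, 'g, 'n, 'i, 'h) state \<Rightarrow> 'p \<Rightarrow> nat \<Rightarrow> ('p, 'h) proof_set set \<Rightarrow> ('p, 'g, 'n, 'i) data \<Rightarrow> bool"
  where "good_cand u p t K v \<longleftrightarrow>
    t \<le> t_fin P \<and> finite K \<and> (\<forall>\<rho>\<in>K. \<exists>x. is_proof P UPDATE t x \<rho>) \<and>
    m_min P \<le> card (proved_hashes P UPDATE t K) \<and>
    (\<forall>\<sigma>\<in>\<Union>K. issued P u \<sigma>) \<and> (\<forall>l<t. committed P (ledger u) l \<noteq> None) \<and>
    (\<exists>J. enrolled P (ledger u) = Some J \<and> v = next_value P (ledger u) J t) \<and>
    (\<forall>q\<in>servers P. (p, q, LocalProof (next_tag P t) (Suc t) (hash P v)) \<in> sent u)"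

lemma next_value_prefix:
  assumes "prefix L L'" "t \<le> t_fin P" "\<forall>l<t. committed P L l \<noteq> None"
  shows "next_value P L J t = next_value P L' J t"
proof (cases "t < t_fin P")
  case True
  then show ?thesis by (simp add: next_value_def)
next
  case False
  \<comment> \<open>Here \<open>t = t_fin P\<close>, so the rounds before \<open>t\<close> are
    exactly those from which the reward is computed.\<close>
  then have "committed P L l = committed P L' l" if "l < t_fin P" for l
    using assms that committed_prefix by fastforce
  then have "map (committed P L) [0..<t_fin P] = map (committed P L') [0..<t_fin P]"
    by simp
  with False show ?thesis
    unfolding next_value_def by (simp only: if_False)
qed

lemma good_cand_mono:
  assumes "good_cand (s i) p t K v" "i \<le> j"
  shows "good_cand (s j) p t K v"
proof -
  obtain J where *: "t \<le> t_fin P" "finite K" "\<forall>\<rho>\<in>K. \<exists>x. is_proof P UPDATE t x \<rho>"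
    "m_min P \<le> card (proved_hashes P UPDATE t K)" "\<forall>\<sigma>\<in>\<Union>K. issued P (s i) \<sigma>"
    "\<forall>l<t. committed P (ledger (s i)) l \<noteq> None" "enrolled P (ledger (s i)) = Some J"
    "v = next_value P (ledger (s i)) J t"
    "\<forall>q\<in>servers P. (p, q, LocalProof (next_tag P t) (Suc t) (hash P v)) \<in> sent (s i)"
    using assms(1) unfolding good_cand_def by (elim conjE exE) (rule that)
  have "enrolled P (ledger (s j)) = Some J"
    using *(7) enrolled_prefix[OF ledger_prefix[OF assms(2)]] by simp
  moreover have "v = next_value P (ledger (s j)) J t"
    using *(8) next_value_prefix[OF ledger_prefix[OF assms(2)] *(1,6)] by simp
  moreover have "\<forall>l<t. committed P (ledger (s j)) l \<noteq> None"
    using *(6) committed_prefix[OF ledger_prefix[OF assms(2)]] by fastforce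
  moreover have "\<forall>\<sigma>\<in>\<Union>K. issued P (s j) \<sigma>"
    using *(5) issued_mono[OF extends[OF assms(2)]] by blast
  moreover have "\<forall>q\<in>servers P. (p, q, LocalProof (next_tag P t) (Suc t) (hash P v)) \<in> sent (s j)"
    using *(9) sent_mono[OF assms(2)] by blast
  ultimately show ?thesis
    using *(1-4) unfolding good_cand_def by blast
qed

text \<open>This collects what is later needed of a correct proposer: its transaction passes the
  ledger's test, the signatures inside its candidate set are genuine, its accompanying value is the
  common one, and it has signed that value.\<close>

lemma cand_good:
  assumes "cand (s i) p t = Some (K, v)"
  shows "good_cand (s i) p t K v"
proof (rule invariantI[where A = "\<lambda>s. cand s p t = Some (K, v)" and i = i])
  fix j assume new: "cand (s j) p t \<noteq> Some (K, v)" "cand (s (Suc j)) p t = Some (K, v)"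
  obtain J F X where X: "p \<in> servers P - byz P" "t \<le> rnd (s j) p" "t \<le> t_fin P"
    "enrolled P (ledger (s j)) = Some J" "X = {x. \<exists>\<pi>. holds_proof P (s j) p UPDATE t x \<pi>}"
    "m_min P \<le> card X" "\<forall>x\<in>X. holds_proof P (s j) p UPDATE t x (F x)"
    "K = F ` X" "v = next_value P (ledger (s j)) J t"
    "\<forall>q\<in>servers P. (p, q, LocalProof (next_tag P t) (Suc t) (hash P v)) \<in> sent (s (Suc j))"
    by (rule step_cand[OF step[of j] new(2,1)]) (rule that)
  have fin: "finite X"
    using X(5) finite_held_hashes by simp
  have "X \<subseteq> proved_hashes P UPDATE t K"
    using X(7,8) by (auto simp: proved_hashes_def holds_proof_def)
  then have "m_min P \<le> card (proved_hashes P UPDATE t K)"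
    using X(6,8) fin card_mono[OF finite_proved_hashes] by (metis finite_imageI order_trans)
  \<comment> \<open>The proposer is in round \<open>t\<close> or later, hence has left every round
    before \<open>t\<close>.\<close>
  moreover have comm: "\<forall>l<t. committed P (ledger (s j)) l \<noteq> None"
    using X(2) rnd_provenance by (meson order_less_le_trans)
  moreover have "\<forall>l<t. committed P (ledger (s (Suc j))) l \<noteq> None"
    using comm committed_Suc[of _ j] by fastforce
  moreover have "v = next_value P (ledger (s (Suc j))) J t"
    using X(3,9) comm next_value_prefix[OF ledger_prefix[OF le_Suc_self]] by simp
  moreover have "enrolled P (ledger (s (Suc j))) = Some J"
    using X(4) enrolled_Suc[of _ j] by simp
  moreover have "\<forall>\<sigma>\<in>\<Union>K. issued P (s (Suc j)) \<sigma>"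
    using X(7,8) holds_proof_issued issued_Suc[of _ j] by fastforce
  moreover have "\<forall>\<rho>\<in>K. \<exists>x. is_proof P UPDATE t x \<rho>"
    using X(7,8) by (auto simp: holds_proof_def)
  ultimately show "good_cand (s (Suc j)) p t K v"
    using X(3,8,10) fin by (auto simp: good_cand_def)
qed (use assms good_cand_mono[OF _ le_Suc_self] in \<open>auto simp: initial_state_def\<close>)

lemma good_cand_value:
  assumes "good_cand u p t K v"
  shows "if t < t_fin P then \<exists>C. v = ClientsV C else \<exists>r. v = RewardV r"
  using assms by (auto simp: good_cand_def next_value_def)

section \<open>Provenance of transactions, announcements, targets and client sets\<close>

lemma TxFirst_valid:
  assumes "(p, TxFirst v \<pi>) \<in> pool (s i)" "p \<notin> byz P"
  shows "valid_first P (p, TxFirst v \<pi>)"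
proof (rule invariantI[where A = "\<lambda>s. (p, TxFirst v \<pi>) \<in> pool s" and i = i])
  fix j assume "(p, TxFirst v \<pi>) \<notin> pool (s j)" "(p, TxFirst v \<pi>) \<in> pool (s (Suc j))"
  then show "valid_first P (p, TxFirst v \<pi>)"
    using step_pool[OF step[of j], of p "TxFirst v \<pi>"] assms(2) by (auto simp: holds_proof_def)
qed (use assms in \<open>auto simp: initial_state_def\<close>)

text \<open>Once such a transaction is ordered, some first valid transaction of the round exists on
  the ledger, though possibly that of another process.\<close>

lemma TxRound_valid:
  assumes "(p, TxRound t K v \<pi>) \<in> pool (s i)" "p \<notin> byz P"
  shows "valid_round P t (p, TxRound t K v \<pi>)"
proof (rule invariantI[where A = "\<lambda>s. (p, TxRound t K v \<pi>) \<in> pool s" and i = i])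
  fix j assume "(p, TxRound t K v \<pi>) \<notin> pool (s j)" "(p, TxRound t K v \<pi>) \<in> pool (s (Suc j))"
  then have "cand (s j) p t = Some (K, v)" "is_proof P (next_tag P t) (Suc t) (hash P v) \<pi>"
    using step_pool[OF step[of j], of p "TxRound t K v \<pi>"] assms(2) by (auto simp: holds_proof_def)
  then show "valid_round P t (p, TxRound t K v \<pi>)"
    using cand_good[of j p t K v] good_cand_value[of "s j" p t K v] by (simp add: good_cand_def)
qed (use assms in \<open>auto simp: initial_state_def\<close>)

lemma TxFinal_valid:
  assumes "(p, TxFinal v \<pi> y \<pi>') \<in> pool (s i)" "p \<notin> byz P"
  shows "valid_final P (p, TxFinal v \<pi> y \<pi>')"
proof (rule invariantI[where A = "\<lambda>s. (p, TxFinal v \<pi> y \<pi>') \<in> pool s" and i = i])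
  fix j assume "(p, TxFinal v \<pi> y \<pi>') \<notin> pool (s j)" "(p, TxFinal v \<pi> y \<pi>') \<in> pool (s (Suc j))"
  then obtain K where "cand (s j) p (t_fin P) = Some (K, v)"
      "is_proof P REWARD (Suc (t_fin P)) (hash P v) \<pi>" "is_proof P MODEL (t_fin P) y \<pi>'"
    using step_pool[OF step[of j], of p "TxFinal v \<pi> y \<pi>'"] assms(2) by (auto simp: holds_proof_def)
  then show "valid_final P (p, TxFinal v \<pi> y \<pi>')"
    using cand_good[of j p "t_fin P" K v] good_cand_value[of "s j" p "t_fin P" K v] by auto
qed (use assms in \<open>auto simp: initial_state_def\<close>)

text \<open>No correctness of \<open>p\<close> is assumed, because the transaction that takes effect
  may be Byzantine: a Byzantine submitter can only use issued signatures, and a correct one has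
  received the signatures as local proofs, which for candidate sets is recorded in
  \<open>good_cand\<close>.\<close>

lemma tx_sigs_issued:
  assumes "(p, x) \<in> pool (s i)" "\<sigma> \<in> tx_sigs x"
  shows "issued P (s i) \<sigma>"
proof (rule invariantI[where A = "\<lambda>s. (p, x) \<in> pool s" and i = i])
  fix j assume "(p, x) \<notin> pool (s j)" "(p, x) \<in> pool (s (Suc j))"
  then have "issued P (s j) \<sigma>"
    using step_pool[OF step[of j], of p x] assms(2) cand_good[of j]
    by (cases x) (auto simp: good_cand_def dest: holds_proof_issued)
  then show "issued P (s (Suc j)) \<sigma>"
    using issued_Suc by auto
qed (use assms in \<open>auto simp: initial_state_def intro: issued_Suc\<close>)

lemma ModelProof_issued:
  assumes "(p, q, ModelProof t x \<pi>) \<in> sent (s i)" "\<sigma> \<in> \<pi>"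
  shows "issued P (s i) \<sigma>"
proof (rule invariantI[where A = "\<lambda>s. (p, q, ModelProof t x \<pi>) \<in> sent s" and i = i])
  fix j assume "(p, q, ModelProof t x \<pi>) \<notin> sent (s j)" "(p, q, ModelProof t x \<pi>) \<in> sent (s (Suc j))"
  then have "issued P (s j) \<sigma>"
    using step_ModelProof[OF step[of j]] assms(2) holds_proof_issued by metis
  then show "issued P (s (Suc j)) \<sigma>"
    using issued_Suc by auto
qed (use assms in \<open>auto simp: initial_state_def intro: issued_Suc\<close>)

lemma proved_model_stored:
  assumes "is_proof P MODEL t x \<pi>" "\<And>\<sigma>. \<sigma> \<in> \<pi> \<Longrightarrow> issued P (s i) \<sigma>"
  shows "\<exists>w q. q \<notin> byz P \<and> x = hash P (ModelV w) \<and>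
    (\<forall>r\<in>replicas P. (q, r, Store x (ModelV w)) \<in> sent (s i))"
proof -
  obtain q r where "q \<in> servers P - byz P" "(q, r, LocalProof MODEL t x) \<in> sent (s i)"
    using correct_signer[OF assms] by blast
  then show ?thesis
    using LocalProof_MODEL[of q r t x i] by blast
qed

text \<open>A target comes from the owner's start transaction or from a model proof with a correct
  signer. The second case already gives storage by a correct process; for the initial model this is
  added once the set-up is known.\<close>

lemma target_provenance:
  assumes "target (s i) k t = Some x"
  shows "(\<forall>r\<in>replicas P. (k, r, Query x) \<in> sent (s i)) \<and>
    (x = hash P (ModelV (initial_model P)) \<or> (\<exists>w q. q \<notin> byz P \<and> x = hash P (ModelV w) \<and>
      (\<forall>r\<in>replicas P. (q, r, Store x (ModelV w)) \<in> sent (s i))))"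
proof (rule invariantI[where A = "\<lambda>s. target s k t = Some x" and i = i])
  fix j assume new: "target (s j) k t \<noteq> Some x" "target (s (Suc j)) k t = Some x"
  note * = step_target[OF step[of j] new(2,1)]
  have "x = hash P (ModelV (initial_model P)) \<or> (\<exists>w q. q \<notin> byz P \<and> x = hash P (ModelV w) \<and>
      (\<forall>r\<in>replicas P. (q, r, Store x (ModelV w)) \<in> sent (s j)))"
  proof (cases t)
    case 0
    then show ?thesis
      using * by (auto dest!: TxStart_hash ledger_pool)
  next
    case (Suc u)
    then obtain q \<pi> where "received (s j) k q (ModelProof u x \<pi>)" "is_proof P MODEL u x \<pi>"
      using * by auto
    then show ?thesis
      using proved_model_stored ModelProof_issued received_sent by metis
  qed
  then show "(\<forall>r\<in>replicas P. (k, r, Query x) \<in> sent (s (Suc j))) \<and>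
    (x = hash P (ModelV (initial_model P)) \<or> (\<exists>w q. q \<notin> byz P \<and> x = hash P (ModelV w) \<and>
      (\<forall>r\<in>replicas P. (q, r, Store x (ModelV w)) \<in> sent (s (Suc j)))))"
    using * sent_all_Suc[of "replicas P" _ _ j] by fast
next
  fix j assume "(\<forall>r\<in>replicas P. (k, r, Query x) \<in> sent (s j)) \<and>
    (x = hash P (ModelV (initial_model P)) \<or> (\<exists>w q. q \<notin> byz P \<and> x = hash P (ModelV w) \<and>
      (\<forall>r\<in>replicas P. (q, r, Store x (ModelV w)) \<in> sent (s j))))"
  then show "(\<forall>r\<in>replicas P. (k, r, Query x) \<in> sent (s (Suc j))) \<and>
    (x = hash P (ModelV (initial_model P)) \<or> (\<exists>w q. q \<notin> byz P \<and> x = hash P (ModelV w) \<and>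
      (\<forall>r\<in>replicas P. (q, r, Store x (ModelV w)) \<in> sent (s (Suc j)))))"
    using sent_all_Suc[of "replicas P" _ _ j] by fast
qed (use assms in \<open>auto simp: initial_state_def\<close>)

text \<open>Targets are never rewritten and the hash is injective, so \<open>w\<close>, and with it
  \<open>g\<close>, is determined by \<open>k\<close> and \<open>t\<close>: a correct client cannot
  send two different updates in a round.\<close>

lemma UpdateMsg_provenance:
  assumes "(k, q, UpdateMsg t g) \<in> sent (s i)" "k \<notin> byz P"
  shows "\<exists>w. target (s i) k t = Some (hash P (ModelV w)) \<and> g = train P k t w"
proof (rule invariantI[where A = "\<lambda>s. (k, q, UpdateMsg t g) \<in> sent s" and i = i])
  fix j assume "(k, q, UpdateMsg t g) \<notin> sent (s j)" "(k, q, UpdateMsg t g) \<in> sent (s (Suc j))"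
  then show "\<exists>w. target (s (Suc j)) k t = Some (hash P (ModelV w)) \<and> g = train P k t w"
    using step_UpdateMsg[OF step[of j]] assms(2) target_Suc[of j] by fastforce
qed (use assms in \<open>auto simp: initial_state_def intro: target_Suc\<close>)

text \<open>Whoever submitted the transaction, its proof has a correct signer, and correct servers
  sign under \<open>CLIENTS\<close> only outputs of \<open>select_clients\<close>. Injectivity of
  the hash turns equal hashes into equal sets.\<close>

lemma client_set_0_eq:
  assumes "client_set P (ledger (s i)) 0 = Some C"
  shows "\<exists>J. enrolled P (ledger (s i)) = Some J \<and> C = select_clients P J 0"
proof -
  obtain p \<pi> where "List.find (valid_first P) (ledger (s i)) = Some (p, TxFirst (ClientsV C) \<pi>)"
    using assms by (auto simp: client_set_0_iff)
  then have tx: "(p, TxFirst (ClientsV C) \<pi>) \<in> pool (s i)"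
      "is_proof P CLIENTS 0 (hash P (ClientsV C)) \<pi>"
    by (auto dest: find_SomeD ledger_pool)
  have issued: "\<And>\<sigma>. \<sigma> \<in> \<pi> \<Longrightarrow> issued P (s i) \<sigma>"
    using tx_sigs_issued[OF tx(1)] by simp
  obtain q r where "q \<in> servers P - byz P" "(q, r, LocalProof CLIENTS 0 (hash P (ClientsV C))) \<in> sent (s i)"
    using correct_signer[OF tx(2)] issued by metis
  then show ?thesis
    using LocalProof_CLIENTS by fastforce
qed

lemma client_set_Suc_eq:
  assumes "client_set P (ledger (s i)) (Suc t) = Some C" "t < t_fin P"
  shows "\<exists>J. enrolled P (ledger (s i)) = Some J \<and> C = select_clients P J (Suc t)"
proof -
  obtain p K \<pi> where "List.find (valid_round P t) (ledger (s i)) = Some (p, TxRound t K (ClientsV C) \<pi>)"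
    using assms by (auto simp: client_set_Suc_iff)
  then have tx: "(p, TxRound t K (ClientsV C) \<pi>) \<in> pool (s i)"
      "is_proof P CLIENTS (Suc t) (hash P (ClientsV C)) \<pi>"
    using assms(2) by (auto dest!: find_SomeD ledger_pool simp: next_tag_def)
  have issued: "\<And>\<sigma>. \<sigma> \<in> \<pi> \<Longrightarrow> issued P (s i) \<sigma>"
    using tx_sigs_issued[OF tx(1)] by simp
  obtain q r where "q \<in> servers P - byz P"
      "(q, r, LocalProof CLIENTS (Suc t) (hash P (ClientsV C))) \<in> sent (s i)"
    using correct_signer[OF tx(2)] issued by metis
  then show ?thesis
    using LocalProof_CLIENTS by fastforce
qed


section \<open>Progress\<close>

lemma eventually_stable:
  assumes "Q (s i)" "\<And>j k. j \<le> k \<Longrightarrow> Q (s j) \<Longrightarrow> Q (s k)"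
  shows "\<forall>\<^sub>F j in sequentially. Q (s j)"
  using assms by (auto simp: eventually_sequentially)

lemma eventually_witness: "\<forall>\<^sub>F j in sequentially. Q j \<Longrightarrow> \<exists>j::nat. Q j"
  by (auto simp: eventually_sequentially)

lemma fair: "fair P s"
  using execution by (simp add: execution_def)

text \<open>If the stable goal \<open>G\<close> never held, the action would be enabled forever from
  some time on, fairness would execute it, and \<open>effect\<close> would establish
  \<open>G\<close>. The disjunction in \<open>enabled\<close> absorbs guards such as
  \<open>cand s p t = None\<close> that the effect itself falsifies. \<open>effect\<close> is asked
  for only eventually, since what an action does may depend on data that have to settle
  first.\<close>

lemma progress:
  assumes "\<not> voluntary a"
    and mono: "\<And>j k. j \<le> k \<Longrightarrow> G (s j) \<Longrightarrow> G (s k)"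
    and enabled: "\<forall>\<^sub>F j in sequentially. G (s j) \<or> (\<exists>s'. act P a (s j) s')"
    and effect: "\<forall>\<^sub>F j in sequentially. act P a (s j) (s (Suc j)) \<longrightarrow> G (s (Suc j))"
  shows "\<forall>\<^sub>F j in sequentially. G (s j)"
proof (cases "\<exists>j. G (s j)")
  case True
  then show ?thesis
    using eventually_stable[of G] mono by blast
next
  case False
  obtain N where N: "\<And>j. j \<ge> N \<Longrightarrow> \<exists>s'. act P a (s j) s'"
      "\<And>j. j \<ge> N \<Longrightarrow> act P a (s j) (s (Suc j)) \<Longrightarrow> G (s (Suc j))"
    using False eventually_conj[OF enabled effect] by (auto simp: eventually_sequentially)
  then obtain j where "j \<ge> N" "act P a (s j) (s (Suc j))"
    using fair assms(1) unfolding fair_def by blast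
  then show ?thesis
    using N False by blast
qed

lemma delivered:
  assumes "p \<notin> byz P" "q \<notin> byz P" "\<forall>\<^sub>F j in sequentially. (p, q, y) \<in> sent (s j)"
  shows "\<forall>\<^sub>F j in sequentially. received (s j) q p y"
proof -
  obtain j where "(p, q, y) \<in> sent (s j)"
    using eventually_witness[OF assms(3)] by blast
  then obtain k where "(p, q, y) \<in> set (inbox (s k) q)"
    using fair assms(1,2) unfolding fair_def by blast
  then show ?thesis
    by (auto simp: received_def eventually_sequentially intro: inbox_mono)
qed

lemma ordered:
  assumes "p \<notin> byz P" "\<forall>\<^sub>F j in sequentially. (p, x) \<in> pool (s j)"
  shows "\<forall>\<^sub>F j in sequentially. (p, x) \<in> set (ledger (s j))"
proof -
  obtain j where "(p, x) \<in> pool (s j)"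
    using eventually_witness[OF assms(2)] by blast
  then obtain k where "(p, x) \<in> set (ledger (s k))"
    using fair assms(1) unfolding fair_def by blast
  then show ?thesis
    by (auto simp: eventually_sequentially intro: ledger_mono)
qed

lemma eventually_sent: "m \<in> sent (s i) \<Longrightarrow> \<forall>\<^sub>F j in sequentially. m \<in> sent (s j)"
  by (auto simp: eventually_sequentially intro: sent_mono)

lemma correct_replica: "\<exists>r. r \<in> replicas P - byz P"
proof (rule ccontr)
  assume "\<nexists>r. r \<in> replicas P - byz P"
  then have "replicas P \<inter> byz P = replicas P"
    by blast
  then show False
    using card_replicas card_byz_replicas by simp
qed

lemma card_correct_servers: "f_s P + 1 \<le> card (servers P - byz P)"
  using card_Diff_subset_Int[of "servers P" "byz P"] finite_servers card_servers card_byz_servers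
  by simp

lemma correct_server: "\<exists>p. p \<in> servers P - byz P"
  using card_correct_servers by (metis add_is_0 card.empty ex_in_conv le_zero_eq zero_neq_one)

text \<open>One correct replica suffices, as \<open>retrieved\<close> discards replies with a wrong
  hash. The times \<open>i\<close> and \<open>i'\<close> are unrelated: a query arriving early stays
  in the inbox and can be answered once the value is stored.\<close>

lemma retrieve:
  assumes q: "q \<notin> byz P" "\<forall>r\<in>replicas P. (q, r, Store (hash P v) v) \<in> sent (s i)"
    and p: "p \<notin> byz P" "\<forall>r\<in>replicas P. (p, r, Query (hash P v)) \<in> sent (s i')"
  shows "\<forall>\<^sub>F j in sequentially. retrieved P (s j) p (hash P v) v"
proof -
  obtain r where r: "r \<in> replicas P" "r \<notin> byz P"
    using correct_replica by blast
  have "\<forall>\<^sub>F j in sequentially. received (s j) r q (Store (hash P v) v)"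
    using delivered eventually_sent q r by blast
  then have en: "\<forall>\<^sub>F j in sequentially. \<exists>s'. act P (StoreValue r (hash P v) v) (s j) s'"
    by (rule eventually_mono) (use r in \<open>blast intro: act.store_value\<close>)
  have "\<forall>\<^sub>F j in sequentially. stored (s j) r (hash P v) \<noteq> None"
  proof (rule progress[where G = "\<lambda>u. stored u r (hash P v) \<noteq> None"])
    show "\<forall>\<^sub>F j in sequentially. act P (StoreValue r (hash P v) v) (s j) (s (Suc j)) \<longrightarrow>
        stored (s (Suc j)) r (hash P v) \<noteq> None"
      by (rule always_eventually) (auto elim!: act.cases)
    show "\<forall>\<^sub>F j in sequentially. stored (s j) r (hash P v) \<noteq> None \<or>
        (\<exists>s'. act P (StoreValue r (hash P v) v) (s j) s')"
      using en by (rule eventually_mono) blast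
  qed (use stored_mono in auto)
  \<comment> \<open>Whatever is stored under the key hashes to it, so by injectivity it is
    \<open>v\<close>.\<close>
  then have st: "\<forall>\<^sub>F j in sequentially. stored (s j) r (hash P v) = Some v"
    by (rule eventually_mono) (use stored_hash in fastforce)
  have rq: "\<forall>\<^sub>F j in sequentially. received (s j) r p (Query (hash P v))"
    using delivered eventually_sent p r by blast
  have "\<forall>\<^sub>F j in sequentially. (r, p, Reply v) \<in> sent (s j)"
  proof (rule progress[where G = "\<lambda>u. (r, p, Reply v) \<in> sent u" and a = "Answer r p (hash P v)"])
    show "\<forall>\<^sub>F j in sequentially. (r, p, Reply v) \<in> sent (s j) \<or>
        (\<exists>s'. act P (Answer r p (hash P v)) (s j) s')"
      using eventually_conj[OF st rq] by (rule eventually_mono) (use r in \<open>blast intro: act.answer\<close>)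
    show "\<forall>\<^sub>F j in sequentially. act P (Answer r p (hash P v)) (s j) (s (Suc j)) \<longrightarrow>
        (r, p, Reply v) \<in> sent (s (Suc j))"
      using st by (rule eventually_mono) (auto elim!: act.cases)
  qed (use sent_mono in auto)
  then have "\<forall>\<^sub>F j in sequentially. received (s j) p r (Reply v)"
    using delivered p r by blast
  then show ?thesis
    by (rule eventually_mono) (use r in \<open>auto simp: retrieved_def\<close>)
qed

text \<open>The proof is made from a set of \<open>f_s + 1\<close> correct servers fixed beforehand,
  so one \<open>\<pi>\<close> serves for all late times. This order of quantifiers keeps the guards
  that mention \<open>\<pi>\<close> enabled.\<close>

lemma quorum:
  assumes "\<And>q. q \<in> servers P - byz P \<Longrightarrow>
      \<forall>\<^sub>F j in sequentially. \<forall>p\<in>servers P. (q, p, LocalProof tag t x) \<in> sent (s j)"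
    and p: "p \<in> servers P - byz P"
  shows "\<exists>\<pi>. \<forall>\<^sub>F j in sequentially. holds_proof P (s j) p tag t x \<pi>"
proof -
  obtain Q where Q: "Q \<subseteq> servers P - byz P" "card Q = f_s P + 1" "finite Q"
    using card_correct_servers obtain_subset_with_card_n by metis
  let ?\<pi> = "(\<lambda>q. Sig q tag t x) ` Q"
  have "is_proof P tag t x ?\<pi>"
    using Q unfolding is_proof_def by blast
  moreover have "\<forall>\<^sub>F j in sequentially. received (s j) p q (LocalProof tag t x)" if "q \<in> Q" for q
    using that Q(1) p by (intro delivered eventually_mono[OF assms(1)[of q]]) auto
  then have "\<forall>\<^sub>F j in sequentially. \<forall>q\<in>Q. received (s j) p q (LocalProof tag t x)"
    using Q(3) by (simp add: eventually_ball_finite)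
  ultimately have "\<forall>\<^sub>F j in sequentially. holds_proof P (s j) p tag t x ?\<pi>"
    by (auto simp: holds_proof_def elim!: eventually_mono)
  then show ?thesis
    by blast
qed

text \<open>The first update from \<open>k\<close> may differ from \<open>g\<close> if
  \<open>k\<close> is Byzantine. The second conjunct lets the uniqueness of a correct client's
  update identify the two.\<close>

lemma first_update_received:
  assumes "received (s i) p k (UpdateMsg t g)"
  shows "\<exists>g' q. first_update (s i) p k t = Some g' \<and> (k, q, UpdateMsg t g') \<in> sent (s i)"
proof -
  have upd: "is_update k t m \<Longrightarrow> \<exists>q g. m = (k, q, UpdateMsg t g)" for m :: "('p, 'g, 'n, 'i, 'h) msg"
    by (induction k t m rule: is_update.induct) auto
  obtain m where m: "List.find (is_update k t) (inbox (s i) p) = Some m"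
      "m \<in> set (inbox (s i) p)" "is_update k t m"
    using find_ex[of "(k, p, UpdateMsg t g)" "inbox (s i) p" "is_update k t"] assms
    by (auto simp: received_def)
  then obtain q g' where "m = (k, q, UpdateMsg t g')"
    using upd by blast
  then show ?thesis
    using m inbox_sent by (force simp: first_update_def)
qed

end

section \<open>Liveness of a task that has been set up, round by round\<close>

locale task_run = run P s
  for P :: "('p, 'g, 'n::finite, 'i, 'h) system"
    and s :: "nat \<Rightarrow> ('p, 'g, 'n, 'i, 'h) state" +
  fixes start :: nat
  assumes clients_suffice: "clients_suffice P s"
    and set_up: "task_set_up P s start"
begin

text \<open>\<open>SOME\<close> merely names the enrolled set: it is defined at some time, and all
  its defined values agree because ledgers at two times are comparable by prefix.\<close>

definition J :: "'p set" where
  "J = (SOME J. \<exists>i. enrolled P (ledger (s i)) = Some J)"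

lemma ex_enrolled: "\<exists>i J. enrolled P (ledger (s i)) = Some J"
  using clients_suffice set_up enough_enrolled unfolding clients_suffice_def by metis

lemma enrolled_unique:
  assumes "enrolled P (ledger (s i)) = Some J'"
  shows "J' = J"
proof -
  obtain j where "enrolled P (ledger (s j)) = Some J"
    unfolding J_def using someI_ex[of "\<lambda>J. \<exists>i. enrolled P (ledger (s i)) = Some J"] ex_enrolled by blast
  then show ?thesis
    using assms enrolled_prefix[OF ledger_prefix, of i "max i j" P]
      enrolled_prefix[OF ledger_prefix, of j "max i j" P] by force
qed

lemma eventually_enrolled: "\<forall>\<^sub>F j in sequentially. enrolled P (ledger (s j)) = Some J"
proof -
  obtain i where "enrolled P (ledger (s i)) = Some J"
    using ex_enrolled enrolled_unique by blast
  then show ?thesis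
    by (auto simp: eventually_sequentially intro: enrolled_prefix ledger_prefix)
qed

abbreviation C :: "nat \<Rightarrow> 'p set" where
  "C t \<equiv> select_clients P J t"

lemma client_subset: "C t \<subseteq> clients P"
proof -
  have "J \<subseteq> clients P"
    using eventually_witness[OF eventually_enrolled] enrolled_subset_clients by blast
  moreover have "C t \<subseteq> J"
    using well_formed by (simp add: well_formed_def)
  ultimately show ?thesis
    by blast
qed

lemma finite_client_set: "finite (C t)"
  using finite_subset[OF client_subset] well_formed by (simp add: well_formed_def)

lemma enough_correct_clients: "t \<le> t_fin P \<Longrightarrow> m_min P \<le> card (C t - byz P)"
  using eventually_witness[OF eventually_enrolled] clients_suffice unfolding clients_suffice_def by blast

lemma set_up_effect:
  "(owner P, TxStart (hash P (ModelV (initial_model P))) (the_task P)) \<in> pool (s (Suc start))"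
  "\<forall>r\<in>replicas P. (owner P, r, Store (hash P (ModelV (initial_model P))) (ModelV (initial_model P)))
     \<in> sent (s (Suc start))"
  using set_up unfolding task_set_up_def by (auto elim!: act.cases)

lemma eventually_started:
  "\<forall>\<^sub>F j in sequentially.
     (owner P, TxStart (hash P (ModelV (initial_model P))) (the_task P)) \<in> set (ledger (s j))"
  using set_up_effect(1) by (intro ordered) (auto simp: eventually_sequentially intro: pool_mono)

lemma first_client_set: "\<forall>\<^sub>F j in sequentially. client_set P (ledger (s j)) 0 = Some (C 0)"
proof -
  let ?v = "ClientsV (C 0) :: ('p, 'g, 'n, 'i) data"
  have signed: "\<forall>\<^sub>F j in sequentially. \<forall>q\<in>servers P. (p, q, LocalProof CLIENTS 0 (hash P ?v)) \<in> sent (s j)"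
    if p: "p \<in> servers P - byz P" for p
  proof (rule progress[where a = "SelectFirst p" and
        G = "\<lambda>u. \<forall>q\<in>servers P. (p, q, LocalProof CLIENTS 0 (hash P ?v)) \<in> sent u"])
    show "\<forall>\<^sub>F j in sequentially. (\<forall>q\<in>servers P. (p, q, LocalProof CLIENTS 0 (hash P ?v)) \<in> sent (s j)) \<or>
        (\<exists>s'. act P (SelectFirst p) (s j) s')"
      using eventually_enrolled by (rule eventually_mono) (use p in \<open>blast intro: act.select_first\<close>)
    show "\<forall>\<^sub>F j in sequentially. act P (SelectFirst p) (s j) (s (Suc j)) \<longrightarrow>
        (\<forall>q\<in>servers P. (p, q, LocalProof CLIENTS 0 (hash P ?v)) \<in> sent (s (Suc j)))"
      using eventually_enrolled
      by (rule eventually_mono) (auto elim!: act.cases simp: sent_build)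
  qed (use sent_mono in auto)
  obtain p where p: "p \<in> servers P - byz P"
    using correct_server by blast
  obtain \<pi> where \<pi>: "\<forall>\<^sub>F j in sequentially. holds_proof P (s j) p CLIENTS 0 (hash P ?v) \<pi>"
    using quorum[OF signed p] by blast
  have "\<forall>\<^sub>F j in sequentially. \<exists>\<rho>. (p, TxFirst ?v \<rho>) \<in> pool (s j)"
  proof (rule progress[where a = "AnnounceFirst p" and G = "\<lambda>u. \<exists>\<rho>. (p, TxFirst ?v \<rho>) \<in> pool u"])
    show "\<forall>\<^sub>F j in sequentially. (\<exists>\<rho>. (p, TxFirst ?v \<rho>) \<in> pool (s j)) \<or>
        (\<exists>s'. act P (AnnounceFirst p) (s j) s')"
      using eventually_conj[OF eventually_enrolled \<pi>]
      by (rule eventually_mono) (use p in \<open>blast intro: act.announce_first\<close>)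
    show "\<forall>\<^sub>F j in sequentially. act P (AnnounceFirst p) (s j) (s (Suc j)) \<longrightarrow>
        (\<exists>\<rho>. (p, TxFirst ?v \<rho>) \<in> pool (s (Suc j)))"
      using eventually_enrolled by (rule eventually_mono) (auto elim!: act.cases)
  qed (simp, meson pool_mono)
  then obtain i \<rho> where \<rho>: "(p, TxFirst ?v \<rho>) \<in> pool (s i)"
    using eventually_witness by blast
  have "\<forall>\<^sub>F j in sequentially. (p, TxFirst ?v \<rho>) \<in> set (ledger (s j))"
    using \<rho> p by (intro ordered) (auto simp: eventually_sequentially intro: pool_mono)
  then show ?thesis
  proof (rule eventually_mono)
    fix j assume "(p, TxFirst ?v \<rho>) \<in> set (ledger (s j))"
    then obtain x where "List.find (valid_first P) (ledger (s j)) = Some x" "valid_first P x"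
      using TxFirst_valid[OF \<rho>] p find_ex by (metis DiffD2)
    then have "client_set P (ledger (s j)) 0 \<noteq> None"
      using valid_first_cases client_set_0_iff by (metis option.distinct(1))
    \<comment> \<open>The transaction that takes effect need not be that of \<open>p\<close>; any
      client set with a valid proof is the common output.\<close>
    then show "client_set P (ledger (s j)) 0 = Some (C 0)"
      using client_set_0_eq enrolled_unique by fastforce
  qed
qed

text \<open>This is the induction hypothesis over rounds. The inequality on \<open>rnd\<close>
  replaces equality because servers move on at different speeds while old handlers stay active. That
  a proved model of the preceding round has been announced is contained in it through
  \<open>rnd_provenance\<close>.\<close>

definition reached :: "nat \<Rightarrow> bool" where
  "reached t \<longleftrightarrow> t \<le> t_fin P \<and>
     (\<forall>p\<in>servers P - byz P. \<forall>\<^sub>F j in sequentially. t \<le> rnd (s j) p) \<and>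
     (\<forall>\<^sub>F j in sequentially. client_set P (ledger (s j)) t = Some (C t))"

lemma model_fetched:
  assumes "reached t" "k \<in> C t - byz P"
  shows "\<exists>x. \<forall>\<^sub>F j in sequentially. target (s j) k t = Some x"
proof -
  have k: "k \<in> clients P - byz P"
    using assms(2) client_subset by blast
  have cs: "\<forall>\<^sub>F j in sequentially. client_set P (ledger (s j)) t = Some (C t)"
    using assms(1) by (simp add: reached_def)
  have "\<forall>\<^sub>F j in sequentially. target (s j) k t \<noteq> None"
  proof (rule progress[where a = "Fetch k t" and G = "\<lambda>u. target u k t \<noteq> None"])
    show "\<forall>\<^sub>F j in sequentially. target (s j) k t \<noteq> None \<or> (\<exists>s'. act P (Fetch k t) (s j) s')"
    proof (cases t)
      case 0
      show ?thesis
        using eventually_conj[OF cs eventually_started] unfolding 0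
        by (rule eventually_mono) (use act.fetch_initial[OF k _ _ _ _ refl] assms(2) 0 in blast)
    next
      case (Suc u)
      obtain p where p: "p \<in> servers P - byz P"
        using correct_server by blast
      then obtain i where "Suc u \<le> rnd (s i) p"
        using assms(1) Suc eventually_witness unfolding reached_def by blast
      \<comment> \<open>A correct server that has left round \<open>u\<close> has announced a model
        proof to every client. This keeps \<open>Fetch\<close> enabled, although the client may
        accept a different proved model.\<close>
      then obtain x \<pi> where \<pi>: "is_proof P MODEL u x \<pi>" "(p, k, ModelProof u x \<pi>) \<in> sent (s i)"
        using rnd_provenance[of u i p] k by auto
      have "\<forall>\<^sub>F j in sequentially. received (s j) k p (ModelProof u x \<pi>)"
        using eventually_sent[OF \<pi>(2)] p k by (intro delivered) auto
      from eventually_conj[OF cs this] show ?thesis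
        unfolding Suc
        by (rule eventually_mono) (use act.fetch[OF k _ _ _ _ _ \<pi>(1) refl] assms(2) Suc p in blast)
    qed
    show "\<forall>\<^sub>F j in sequentially. act P (Fetch k t) (s j) (s (Suc j)) \<longrightarrow> target (s (Suc j)) k t \<noteq> None"
      by (rule always_eventually) (auto elim!: act.cases)
  qed (simp, metis target_mono not_None_eq)
  then obtain i x where "target (s i) k t = Some x"
    using eventually_witness by blast
  then show ?thesis
    by (auto simp: eventually_sequentially intro: target_mono)
qed

text \<open>The last conjunct ranges over all receivers and times, so that whatever a correct server
  sees first from \<open>k\<close> is this \<open>g\<close>; only then do the servers sign the same
  hash.\<close>

lemma update_sent:
  assumes "reached t" "k \<in> C t - byz P"
  shows "\<exists>g. well_formatted P g \<and>
    (\<forall>\<^sub>F j in sequentially. \<forall>p\<in>servers P. (k, p, UpdateMsg t g) \<in> sent (s j)) \<and>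
    (\<forall>j q g'. (k, q, UpdateMsg t g') \<in> sent (s j) \<longrightarrow> g' = g)"
proof -
  obtain x where x: "\<forall>\<^sub>F j in sequentially. target (s j) k t = Some x"
    using model_fetched[OF assms] by blast
  obtain i where i: "target (s i) k t = Some x"
    using eventually_witness[OF x] by blast
  \<comment> \<open>The storing process \<open>q\<close> is the owner for the initial model, and a
    correct signer of the proof otherwise.\<close>
  obtain w q i' where w: "x = hash P (ModelV w)" "q \<notin> byz P"
      "\<forall>r\<in>replicas P. (q, r, Store (hash P (ModelV w)) (ModelV w)) \<in> sent (s i')"
    using target_provenance[OF i] set_up_effect(2) owner_correct by blast
  have "\<forall>\<^sub>F j in sequentially. retrieved P (s j) k x (ModelV w)"
    unfolding w(1) by (rule retrieve[OF w(2,3)]) (use target_provenance[OF i] assms(2) w(1) in auto)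
  note ret = eventually_conj[OF x this]
  have k: "k \<in> clients P - byz P"
    using assms(2) client_subset by blast
  have "\<forall>\<^sub>F j in sequentially. \<forall>p\<in>servers P. (k, p, UpdateMsg t (train P k t w)) \<in> sent (s j)"
  proof (rule progress[where a = "Train k t" and
        G = "\<lambda>u. \<forall>p\<in>servers P. (k, p, UpdateMsg t (train P k t w)) \<in> sent u"])
    show "\<forall>\<^sub>F j in sequentially. (\<forall>p\<in>servers P. (k, p, UpdateMsg t (train P k t w)) \<in> sent (s j)) \<or>
        (\<exists>s'. act P (Train k t) (s j) s')"
      using ret by (rule eventually_mono) (use k in \<open>blast intro: act.train\<close>)
    show "\<forall>\<^sub>F j in sequentially. act P (Train k t) (s j) (s (Suc j)) \<longrightarrow>
        (\<forall>p\<in>servers P. (k, p, UpdateMsg t (train P k t w)) \<in> sent (s (Suc j)))"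
      using x by (rule eventually_mono) (auto elim!: act.cases simp: retrieved_def w(1))
  qed (use sent_mono in auto)
  moreover have "g' = train P k t w" if upd: "(k, q', UpdateMsg t g') \<in> sent (s j)" for j q' g'
  proof -
    obtain w' where "target (s j) k t = Some (hash P (ModelV w'))" "g' = train P k t w'"
      using UpdateMsg_provenance[OF upd] k by blast
    then show ?thesis
      using target_mono[of j "max i j"] target_mono[of i "max i j"] i w(1) by fastforce
  qed
  moreover have "well_formatted P (train P k t w)"
    using well_formed by (simp add: well_formed_def)
  ultimately show ?thesis
    by blast
qed

lemma update_proved:
  assumes "reached t" "k \<in> C t - byz P"
  shows "\<exists>g. \<forall>p\<in>servers P - byz P.
    \<exists>\<pi>. \<forall>\<^sub>F j in sequentially. holds_proof P (s j) p UPDATE t (hash P (UpdateV k t g)) \<pi>"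
proof -
  obtain g where g: "well_formatted P g"
      "\<forall>\<^sub>F j in sequentially. \<forall>p\<in>servers P. (k, p, UpdateMsg t g) \<in> sent (s j)"
      "\<And>j q g'. (k, q, UpdateMsg t g') \<in> sent (s j) \<Longrightarrow> g' = g"
    using update_sent[OF assms] by blast
  let ?x = "hash P (UpdateV k t g)"
  have signed: "\<forall>\<^sub>F j in sequentially. \<forall>q\<in>servers P. (p, q, LocalProof UPDATE t ?x) \<in> sent (s j)"
    if p: "p \<in> servers P - byz P" for p
  proof -
    have rnd: "\<forall>\<^sub>F j in sequentially. t \<le> rnd (s j) p" and tfin: "t \<le> t_fin P"
      and cs: "\<forall>\<^sub>F j in sequentially. client_set P (ledger (s j)) t = Some (C t)"
      using assms(1) p by (auto simp: reached_def)
    have "\<forall>\<^sub>F j in sequentially. received (s j) p k (UpdateMsg t g)"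
      by (rule delivered) (use assms(2) p g(2) in \<open>auto elim: eventually_mono\<close>)
    then have fu: "\<forall>\<^sub>F j in sequentially. first_update (s j) p k t = Some g"
      by (rule eventually_mono) (use first_update_received g(3) in blast)
    have lv: "\<forall>\<^sub>F j in sequentially. locally_valid P (s j) p UPDATE t (UpdateV k t g)"
      using cs by (rule eventually_mono) (use g(1) assms(2) in auto)
    show ?thesis
    proof (rule progress[where a = "SignUpdate p t k" and
          G = "\<lambda>u. \<forall>q\<in>servers P. (p, q, LocalProof UPDATE t ?x) \<in> sent u"])
      show "\<forall>\<^sub>F j in sequentially. (\<forall>q\<in>servers P. (p, q, LocalProof UPDATE t ?x) \<in> sent (s j)) \<or>
          (\<exists>s'. act P (SignUpdate p t k) (s j) s')"
        using eventually_conj[OF rnd eventually_conj[OF fu lv]]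
        by (rule eventually_mono) (use p tfin in \<open>blast intro: act.sign_update\<close>)
      show "\<forall>\<^sub>F j in sequentially. act P (SignUpdate p t k) (s j) (s (Suc j)) \<longrightarrow>
          (\<forall>q\<in>servers P. (p, q, LocalProof UPDATE t ?x) \<in> sent (s (Suc j)))"
        using fu by (rule eventually_mono) (auto elim!: act.cases simp: sent_build)
    qed (use sent_mono in auto)
  qed
  show ?thesis
    using quorum[OF signed] by blast
qed

lemma proposed:
  assumes "reached t" "p \<in> servers P - byz P"
  shows "\<exists>K v. \<forall>\<^sub>F j in sequentially. cand (s j) p t = Some (K, v)"
proof -
  have rnd: "\<forall>\<^sub>F j in sequentially. t \<le> rnd (s j) p" and tfin: "t \<le> t_fin P"
    using assms by (auto simp: reached_def)
  obtain g where g: "\<And>k. k \<in> C t - byz P \<Longrightarrow>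
      \<exists>\<pi>. \<forall>\<^sub>F j in sequentially. holds_proof P (s j) p UPDATE t (hash P (UpdateV k t (g k))) \<pi>"
    using update_proved[OF assms(1)] assms(2) by metis
  let ?U = "(\<lambda>k. hash P (UpdateV k t (g k))) ` (C t - byz P)"
  have "card ?U = card (C t - byz P)"
    \<comment> \<open>\<open>UpdateV\<close> contains the client, so distinct clients give distinct
      hashes even if the contents of their updates coincide.\<close>
    by (rule card_image) (auto simp: inj_on_def)
  then have card: "m_min P \<le> card ?U"
    using enough_correct_clients[OF tfin] by simp
  have "\<forall>k\<in>C t - byz P. \<forall>\<^sub>F j in sequentially. \<exists>\<pi>. holds_proof P (s j) p UPDATE t (hash P (UpdateV k t (g k))) \<pi>"
  proof
    fix k assume "k \<in> C t - byz P"
    then obtain \<pi> where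
      "\<forall>\<^sub>F j in sequentially. holds_proof P (s j) p UPDATE t (hash P (UpdateV k t (g k))) \<pi>"
      using g by blast
    then show "\<forall>\<^sub>F j in sequentially.
        \<exists>\<pi>. holds_proof P (s j) p UPDATE t (hash P (UpdateV k t (g k))) \<pi>"
      by (rule eventually_mono) blast
  qed
  \<comment> \<open>Each client has its own time from which its proof is held; finiteness of the
    client set gives a common one.\<close>
  then have all: "\<forall>\<^sub>F j in sequentially. \<forall>k\<in>C t - byz P.
      \<exists>\<pi>. holds_proof P (s j) p UPDATE t (hash P (UpdateV k t (g k))) \<pi>"
    using finite_client_set by (simp add: eventually_ball_finite)
  have "\<forall>\<^sub>F j in sequentially. cand (s j) p t \<noteq> None"
  proof (rule progress[where a = "Propose p t" and G = "\<lambda>u. cand u p t \<noteq> None"])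
    show "\<forall>\<^sub>F j in sequentially. cand (s j) p t \<noteq> None \<or> (\<exists>s'. act P (Propose p t) (s j) s')"
      using eventually_conj[OF eventually_enrolled eventually_conj[OF rnd all]]
    proof (rule eventually_mono)
      fix j assume j: "enrolled P (ledger (s j)) = Some J \<and> t \<le> rnd (s j) p \<and> (\<forall>k\<in>C t - byz P.
        \<exists>\<pi>. holds_proof P (s j) p UPDATE t (hash P (UpdateV k t (g k))) \<pi>)"
      define X where "X = {x. \<exists>\<pi>. holds_proof P (s j) p UPDATE t x \<pi>}"
      have "?U \<subseteq> X"
        using j by (auto simp: X_def)
      moreover have "finite X"
        unfolding X_def by (rule finite_held_hashes)
      ultimately have "m_min P \<le> card X"
        using card card_mono[of X ?U] by linarith
      moreover obtain F where "\<forall>x\<in>X. holds_proof P (s j) p UPDATE t x (F x)"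
        using bchoice[of X "holds_proof P (s j) p UPDATE t"] unfolding X_def by blast
      ultimately show "cand (s j) p t \<noteq> None \<or> (\<exists>s'. act P (Propose p t) (s j) s')"
        using act.propose[OF assms(2) _ tfin _ _ X_def _ _ refl refl, of "J"] j by blast
    qed
    show "\<forall>\<^sub>F j in sequentially. act P (Propose p t) (s j) (s (Suc j)) \<longrightarrow> cand (s (Suc j)) p t \<noteq> None"
      by (rule always_eventually) (auto elim!: act.cases)
  qed (simp, metis cand_mono not_None_eq)
  then obtain i K v where "cand (s i) p t = Some (K, v)"
    using eventually_witness by fastforce
  then show ?thesis
    by (auto simp: eventually_sequentially intro: cand_mono)
qed

text \<open>Signatures of different servers count together only on one hash, hence \<open>v\<close>
  is chosen before \<open>p\<close>. The candidate set \<open>K\<close> depends on which proofs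
  arrived in time and may differ between servers.\<close>

lemma cand_proved:
  assumes "reached t"
  shows "\<exists>v. \<forall>p\<in>servers P - byz P. \<exists>K \<pi>. \<forall>\<^sub>F j in sequentially.
    cand (s j) p t = Some (K, v) \<and> holds_proof P (s j) p (next_tag P t) (Suc t) (hash P v) \<pi>"
proof -
  obtain p0 where p0: "p0 \<in> servers P - byz P"
    using correct_server by blast
  obtain K0 v i0 where c0: "cand (s i0) p0 t = Some (K0, v)"
    using proposed[OF assms p0] eventually_witness by blast
  \<comment> \<open>Both candidates are examined at time \<open>max i i0\<close>:
    \<open>good_cand\<close> survives until then and evaluates both values in the same
    ledger.\<close>
  have same: "v' = v" if c: "cand (s i) p t = Some (K, v')" for i p K v'
    using cand_good[OF cand_mono[OF max.cobounded1 c, of i0]]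
      cand_good[OF cand_mono[OF max.cobounded2 c0, of i]] by (auto simp: good_cand_def)
  have cand: "\<exists>K. \<forall>\<^sub>F j in sequentially. cand (s j) p t = Some (K, v)"
    if p: "p \<in> servers P - byz P" for p
  proof -
    obtain K v' where e: "\<forall>\<^sub>F j in sequentially. cand (s j) p t = Some (K, v')"
      using proposed[OF assms p] by blast
    then show ?thesis
      using eventually_witness[OF e] same by blast
  qed
  have "\<forall>\<^sub>F j in sequentially.
      \<forall>q\<in>servers P. (p, q, LocalProof (next_tag P t) (Suc t) (hash P v)) \<in> sent (s j)"
    if p: "p \<in> servers P - byz P" for p
  proof -
    obtain K where "\<forall>\<^sub>F j in sequentially. cand (s j) p t = Some (K, v)"
      using cand[OF p] by blast
    then show ?thesis
      by (rule eventually_mono) (use cand_good in \<open>fastforce simp: good_cand_def\<close>)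
  qed
  then have "\<exists>\<pi>. \<forall>\<^sub>F j in sequentially. holds_proof P (s j) p (next_tag P t) (Suc t) (hash P v) \<pi>"
    if "p \<in> servers P - byz P" for p
    using quorum that by blast
  then show ?thesis
    unfolding eventually_conj_iff using cand by blast
qed

lemma round_committed:
  assumes "reached t"
  shows "\<forall>\<^sub>F j in sequentially. \<exists>x. List.find (valid_round P t) (ledger (s j)) = Some x"
proof -
  obtain p where p: "p \<in> servers P - byz P"
    using correct_server by blast
  then obtain K v \<pi> where c: "\<forall>\<^sub>F j in sequentially. cand (s j) p t = Some (K, v) \<and>
      holds_proof P (s j) p (next_tag P t) (Suc t) (hash P v) \<pi>"
    using cand_proved[OF assms] by blast
  have "\<forall>\<^sub>F j in sequentially. \<exists>\<rho>. (p, TxRound t K v \<rho>) \<in> pool (s j)"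
  proof (rule progress[where a = "SubmitRound p t" and G = "\<lambda>u. \<exists>\<rho>. (p, TxRound t K v \<rho>) \<in> pool u"])
    show "\<forall>\<^sub>F j in sequentially. (\<exists>\<rho>. (p, TxRound t K v \<rho>) \<in> pool (s j)) \<or>
        (\<exists>s'. act P (SubmitRound p t) (s j) s')"
      using c by (rule eventually_mono) (use p in \<open>blast intro: act.submit_round\<close>)
    show "\<forall>\<^sub>F j in sequentially. act P (SubmitRound p t) (s j) (s (Suc j)) \<longrightarrow>
        (\<exists>\<rho>. (p, TxRound t K v \<rho>) \<in> pool (s (Suc j)))"
      using c by (rule eventually_mono) (auto elim!: act.cases)
  qed (simp, meson pool_mono)
  then obtain i \<rho> where \<rho>: "(p, TxRound t K v \<rho>) \<in> pool (s i)"
    using eventually_witness by blast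
  have "\<forall>\<^sub>F j in sequentially. (p, TxRound t K v \<rho>) \<in> set (ledger (s j))"
    using \<rho> p by (intro ordered) (auto simp: eventually_sequentially intro: pool_mono)
  then show ?thesis
    by (rule eventually_mono) (use TxRound_valid[OF \<rho>] p find_ex in fast)
qed

text \<open>The winning transaction of round \<open>t\<close> may carry a Byzantine server's choice
  of updates, but \<open>valid_round\<close> forces a proved client set below the last round, and
  such a set is unique.\<close>

lemma next_client_set:
  assumes "reached t" "t < t_fin P"
  shows "\<forall>\<^sub>F j in sequentially. client_set P (ledger (s j)) (Suc t) = Some (C (Suc t))"
  using round_committed[OF assms(1)]
proof (rule eventually_mono)
  fix j assume "\<exists>x. List.find (valid_round P t) (ledger (s j)) = Some x"
  then obtain x where x: "List.find (valid_round P t) (ledger (s j)) = Some x" "valid_round P t x"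
    using find_SomeD by fast
  obtain p K v \<pi> where e: "x = (p, TxRound t K v \<pi>)"
    by (rule find_valid_round[OF x(1)])
  then obtain C' where "v = ClientsV C'"
    using x(2) assms(2) by auto
  then have "client_set P (ledger (s j)) (Suc t) \<noteq> None"
    using x(1) e client_set_Suc_iff[of P "ledger (s j)" t C'] by auto
  then show "client_set P (ledger (s j)) (Suc t) = Some (C (Suc t))"
    using client_set_Suc_eq[OF _ assms(2)] enrolled_unique by fastforce
qed

lemma committed_updates_read:
  assumes "reached t" "p \<in> servers P - byz P" "committed P (ledger (s i)) t = Some K"
    and "x \<in> proved_hashes P UPDATE t K"
  shows "\<forall>\<^sub>F j in sequentially. \<exists>k g. has_update P (s j) p t x k g"
\<comment> \<open>\<open>ReadUpdate\<close> is enabled only while the update is missing. Either it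
  is present at some time and stays, or the guard holds forever and fairness applies.\<close>
proof (cases "\<exists>j k g. has_update P (s j) p t x k g")
  case True
  then show ?thesis
    using has_update_mono[OF extends] unfolding eventually_sequentially by blast
next
  case False
  have rnd: "\<forall>\<^sub>F j in sequentially. t \<le> rnd (s j) p"
    using assms by (auto simp: reached_def)
  have com: "\<forall>\<^sub>F j in sequentially. committed P (ledger (s j)) t = Some K"
    using committed_prefix[OF ledger_prefix assms(3)] unfolding eventually_sequentially by blast
  \<comment> \<open>The submitter \<open>p'\<close> may be Byzantine, but the proof
    \<open>\<rho>\<close> inside its candidate set has a correct signer, which has sent the update
    to all replicas.\<close>
  obtain p' v \<pi> where "(p', TxRound t K v \<pi>) \<in> pool (s i)"
    using assms(3) by (auto simp: committed_Some_iff dest!: find_SomeD ledger_pool)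
  moreover obtain \<rho> where "\<rho> \<in> K" "is_proof P UPDATE t x \<rho>"
    using assms(4) by (auto simp: proved_hashes_def)
  ultimately obtain q r where q: "q \<notin> byz P" "(q, r, LocalProof UPDATE t x) \<in> sent (s i)"
    using correct_signer[of UPDATE t x \<rho> i] tx_sigs_issued[of p' "TxRound t K v \<pi>" i]
    by (metis DiffD2 UnI1 UnionI tx_sigs.simps(2))
  then obtain k g where g: "x = hash P (UpdateV k t g)"
      "\<forall>r\<in>replicas P. (q, r, Store (hash P (UpdateV k t g)) (UpdateV k t g)) \<in> sent (s i)"
    using LocalProof_UPDATE by blast
  have "\<forall>\<^sub>F j in sequentially. \<forall>r\<in>replicas P. (p, r, Query x) \<in> sent (s j)"
  proof (rule progress[where a = "ReadUpdate p t x" and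
        G = "\<lambda>u. \<forall>r\<in>replicas P. (p, r, Query x) \<in> sent u"])
    show "\<forall>\<^sub>F j in sequentially. (\<forall>r\<in>replicas P. (p, r, Query x) \<in> sent (s j)) \<or>
        (\<exists>s'. act P (ReadUpdate p t x) (s j) s')"
      using eventually_conj[OF rnd com]
      by (rule eventually_mono) (use assms(2,4) False in \<open>blast intro: act.read_update\<close>)
    show "\<forall>\<^sub>F j in sequentially. act P (ReadUpdate p t x) (s j) (s (Suc j)) \<longrightarrow>
        (\<forall>r\<in>replicas P. (p, r, Query x) \<in> sent (s (Suc j)))"
      by (rule always_eventually) (auto elim!: act.cases)
  qed (use sent_mono in auto)
  then obtain i' where "\<forall>r\<in>replicas P. (p, r, Query (hash P (UpdateV k t g))) \<in> sent (s i')"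
    using eventually_witness g(1) by blast
  then have "\<forall>\<^sub>F j in sequentially. retrieved P (s j) p x (UpdateV k t g)"
    using retrieve[OF q(1) g(2)] assms(2) g(1) by auto
  then show ?thesis
    by (rule eventually_mono) (use g(1) in \<open>auto simp: has_update_def\<close>)
qed

lemma aggregated:
  assumes "reached t" "p \<in> servers P - byz P"
  shows "\<exists>w. \<forall>\<^sub>F j in sequentially. local_model (s j) p t = Some w"
proof -
  have rnd: "\<forall>\<^sub>F j in sequentially. t \<le> rnd (s j) p"
    using assms by (auto simp: reached_def)
  obtain i y where y: "List.find (valid_round P t) (ledger (s i)) = Some y"
    using round_committed[OF assms(1)] eventually_witness by blast
  obtain p' K v \<pi> where e: "y = (p', TxRound t K v \<pi>)"
    by (rule find_valid_round[OF y])
  then have fin: "finite K"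
    using find_SomeD[OF y] by simp
  have i: "committed P (ledger (s i)) t = Some K"
    using y e by (simp add: committed_Some_iff)
  then have com: "\<forall>\<^sub>F j in sequentially. committed P (ledger (s j)) t = Some K"
    using committed_prefix[OF ledger_prefix] unfolding eventually_sequentially by blast
  \<comment> \<open>\<open>valid_round\<close> demands a finite \<open>K\<close>, so waiting for all
    committed updates is a finite conjunction of eventual facts.\<close>
  have upd: "\<forall>\<^sub>F j in sequentially. \<forall>x\<in>proved_hashes P UPDATE t K. \<exists>k g. has_update P (s j) p t x k g"
    by (rule eventually_ball_finite[OF finite_proved_hashes[OF fin]])
      (use committed_updates_read[OF assms i] in blast)
  have "\<forall>\<^sub>F j in sequentially. local_model (s j) p t \<noteq> None"
  proof (rule progress[where a = "Aggregate p t" and G = "\<lambda>u. local_model u p t \<noteq> None"])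
    show "\<forall>\<^sub>F j in sequentially. local_model (s j) p t \<noteq> None \<or> (\<exists>s'. act P (Aggregate p t) (s j) s')"
      using eventually_conj[OF rnd eventually_conj[OF com upd]]
      by (rule eventually_mono) (use act.aggregate[OF assms(2) _ _ _ refl _ refl refl] in blast)
    show "\<forall>\<^sub>F j in sequentially. act P (Aggregate p t) (s j) (s (Suc j)) \<longrightarrow>
        local_model (s (Suc j)) p t \<noteq> None"
      by (rule always_eventually) (auto elim!: act.cases)
  qed (simp, metis local_model_mono not_None_eq)
  then obtain i w where "local_model (s i) p t = Some w"
    using eventually_witness by blast
  then show ?thesis
    by (auto simp: eventually_sequentially intro: local_model_mono)
qed

text \<open>
  Every correct server accepts the model of any one correct server, being close to its own; so
  that model collects enough signatures.
\<close>

lemma model_proved: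
  assumes "reached t"
  shows "\<exists>x. \<forall>p\<in>servers P - byz P. \<exists>\<pi>. \<forall>\<^sub>F j in sequentially. holds_proof P (s j) p MODEL t x \<pi>"
proof -
  obtain q where q: "q \<in> servers P - byz P"
    using correct_server by blast
  obtain w where w: "\<forall>\<^sub>F j in sequentially. local_model (s j) q t = Some w"
    using aggregated[OF assms q] by blast
  let ?x = "hash P (ModelV w)"
  have signed: "\<forall>\<^sub>F j in sequentially. \<forall>r\<in>servers P. (p, r, LocalProof MODEL t ?x) \<in> sent (s j)"
    if p: "p \<in> servers P - byz P" for p
  proof -
    obtain w' where w': "\<forall>\<^sub>F j in sequentially. local_model (s j) p t = Some w'"
      using aggregated[OF assms p] by blast
    have lv: "\<forall>\<^sub>F j in sequentially. locally_valid P (s j) p MODEL t (ModelV w)"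
      using eventually_conj[OF w w']
      by (rule eventually_mono) (use models_close p q in \<open>auto simp: models_close_def\<close>)
    have "\<forall>\<^sub>F j in sequentially. (q, p, ModelMsg t w) \<in> sent (s j)"
      using w by (rule eventually_mono) (use local_model_provenance p in blast)
    then have "\<forall>\<^sub>F j in sequentially. received (s j) p q (ModelMsg t w)"
      using delivered p q by blast
    note en = eventually_conj[OF this lv]
    show ?thesis
    proof (rule progress[where a = "SignModel p t w" and
          G = "\<lambda>u. \<forall>r\<in>servers P. (p, r, LocalProof MODEL t ?x) \<in> sent u"])
      show "\<forall>\<^sub>F j in sequentially. (\<forall>r\<in>servers P. (p, r, LocalProof MODEL t ?x) \<in> sent (s j)) \<or>
          (\<exists>s'. act P (SignModel p t w) (s j) s')"
        using en by (rule eventually_mono) (use act.sign_model[OF p _ _ _ refl] q in blast)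
      show "\<forall>\<^sub>F j in sequentially. act P (SignModel p t w) (s j) (s (Suc j)) \<longrightarrow>
          (\<forall>r\<in>servers P. (p, r, LocalProof MODEL t ?x) \<in> sent (s (Suc j)))"
        by (rule always_eventually) (auto elim!: act.cases)
    qed (use sent_mono in auto)
  qed
  show ?thesis
    using quorum[OF signed] by blast
qed

lemma advanced:
  assumes "reached t" "p \<in> servers P - byz P"
  shows "\<forall>\<^sub>F j in sequentially. Suc t \<le> rnd (s j) p"
proof -
  have rnd: "\<forall>\<^sub>F j in sequentially. t \<le> rnd (s j) p" and tfin: "t \<le> t_fin P"
    using assms by (auto simp: reached_def)
  obtain x \<pi> where "\<forall>\<^sub>F j in sequentially. holds_proof P (s j) p MODEL t x \<pi>"
    using model_proved[OF assms(1)] assms(2) by blast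
  note en = eventually_conj[OF rnd this]
  show ?thesis
  proof (rule progress[where a = "Advance p t" and G = "\<lambda>u. Suc t \<le> rnd u p"])
    show "\<forall>\<^sub>F j in sequentially. Suc t \<le> rnd (s j) p \<or> (\<exists>s'. act P (Advance p t) (s j) s')"
      using en
    proof (rule eventually_mono)
      fix j assume j: "t \<le> rnd (s j) p \<and> holds_proof P (s j) p MODEL t x \<pi>"
      \<comment> \<open>\<open>advance\<close> requires \<open>rnd\<close> to be exactly
        \<open>t\<close>; a server already beyond \<open>t\<close>, perhaps through a proof of
        another model, satisfies the left disjunct.\<close>
      show "Suc t \<le> rnd (s j) p \<or> (\<exists>s'. act P (Advance p t) (s j) s')"
        using j act.advance[OF assms(2) _ tfin _ refl, of "s j" x \<pi>] by fastforce
    qed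
    show "\<forall>\<^sub>F j in sequentially. act P (Advance p t) (s j) (s (Suc j)) \<longrightarrow> Suc t \<le> rnd (s (Suc j)) p"
      by (rule always_eventually) (auto elim!: act.cases)
  qed (simp, meson rnd_mono order_trans)
qed

lemma all_rounds_reached: "t \<le> t_fin P \<Longrightarrow> reached t"
proof (induction t)
  case 0
  then show ?case
    using first_client_set by (simp add: reached_def)
next
  case (Suc t)
  then show ?case
    using advanced[of t] next_client_set[of t] by (simp add: reached_def)
qed

section \<open>End of the task and reading of the final model\<close>

lemma final_model_known: "\<exists>x. \<forall>\<^sub>F j in sequentially. final_model_hash P (ledger (s j)) = Some x"
proof -
  have r: "reached (t_fin P)"
    by (simp add: all_rounds_reached)
  obtain p where p: "p \<in> servers P - byz P"
    using correct_server by blast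
  \<comment> \<open>In the last round the proved value accompanying the candidate set is the
    rewarding information that the final transaction needs.\<close>
  have tag: "next_tag P (t_fin P) = REWARD"
    by (simp add: next_tag_def)
  obtain K v \<pi> where c: "\<forall>\<^sub>F j in sequentially. cand (s j) p (t_fin P) = Some (K, v) \<and>
      holds_proof P (s j) p REWARD (Suc (t_fin P)) (hash P v) \<pi>"
    using cand_proved[OF r, unfolded tag] p by blast
  obtain x \<pi>' where "\<forall>\<^sub>F j in sequentially. holds_proof P (s j) p MODEL (t_fin P) x \<pi>'"
    using model_proved[OF r] p by blast
  note en = eventually_conj[OF c this]
  have "\<forall>\<^sub>F j in sequentially. \<exists>u \<rho> y \<rho>'. (p, TxFinal u \<rho> y \<rho>') \<in> pool (s j)"
  proof (rule progress[where a = "SubmitFinal p" and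
        G = "\<lambda>st. \<exists>u \<rho> y \<rho>'. (p, TxFinal u \<rho> y \<rho>') \<in> pool st"])
    show "\<forall>\<^sub>F j in sequentially. (\<exists>u \<rho> y \<rho>'. (p, TxFinal u \<rho> y \<rho>') \<in> pool (s j)) \<or>
        (\<exists>s'. act P (SubmitFinal p) (s j) s')"
      using en by (rule eventually_mono) (use p in \<open>blast intro: act.submit_final\<close>)
    show "\<forall>\<^sub>F j in sequentially. act P (SubmitFinal p) (s j) (s (Suc j)) \<longrightarrow>
        (\<exists>u \<rho> y \<rho>'. (p, TxFinal u \<rho> y \<rho>') \<in> pool (s (Suc j)))"
      by (rule always_eventually) (auto elim!: act.cases)
  qed (simp, meson pool_mono)
  then obtain i u \<rho> y \<rho>' where tx: "(p, TxFinal u \<rho> y \<rho>') \<in> pool (s i)"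
    using eventually_witness by blast
  have "\<forall>\<^sub>F j in sequentially. (p, TxFinal u \<rho> y \<rho>') \<in> set (ledger (s j))"
    using tx p by (intro ordered) (auto simp: eventually_sequentially intro: pool_mono)
  then obtain j where "(p, TxFinal u \<rho> y \<rho>') \<in> set (ledger (s j))"
    using eventually_witness by blast
  \<comment> \<open>The transaction \<open>z\<close> may differ from the one of \<open>p\<close> and
    carry another proved model; the resulting hash is only required to stay fixed.\<close>
  then obtain z where "List.find (valid_final P) (ledger (s j)) = Some z" "valid_final P z"
    using TxFinal_valid[OF tx] p find_ex by (metis DiffD2)
  then obtain x' where "final_model_hash P (ledger (s j)) = Some x'"
    using final_model_hash_iff valid_final_cases by metis
  then show ?thesis
    using final_model_hash_prefix[OF ledger_prefix] unfolding eventually_sequentially by blast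
qed

lemma model_obtained: "\<exists>j>i. \<exists>w. obtains_trained_model P (s j) w"
proof -
  obtain x where x: "\<forall>\<^sub>F j in sequentially. final_model_hash P (ledger (s j)) = Some x"
    using final_model_known by blast
  then obtain i0 where "final_model_hash P (ledger (s i0)) = Some x"
    using eventually_witness by blast
  then obtain p r \<pi> \<pi>' where "(p, TxFinal (RewardV r) \<pi> x \<pi>') \<in> pool (s i0)"
      "is_proof P MODEL (t_fin P) x \<pi>'"
    by (auto simp: final_model_hash_iff dest!: find_SomeD ledger_pool)
  then obtain w q where w: "q \<notin> byz P" "x = hash P (ModelV w)"
      "\<forall>r\<in>replicas P. (q, r, Store (hash P (ModelV w)) (ModelV w)) \<in> sent (s i0)"
    using proved_model_stored[of "t_fin P" x \<pi>' i0] tx_sigs_issued[of p _ i0] by fastforce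
  have "\<forall>\<^sub>F j in sequentially. \<forall>r\<in>replicas P. (owner P, r, Query x) \<in> sent (s j)"
  proof (rule progress[where a = OwnerQuery and
        G = "\<lambda>u. \<forall>r\<in>replicas P. (owner P, r, Query x) \<in> sent u"])
    show "\<forall>\<^sub>F j in sequentially. (\<forall>r\<in>replicas P. (owner P, r, Query x) \<in> sent (s j)) \<or>
        (\<exists>s'. act P OwnerQuery (s j) s')"
      using x by (rule eventually_mono) (blast intro: act.owner_query)
    show "\<forall>\<^sub>F j in sequentially. act P OwnerQuery (s j) (s (Suc j)) \<longrightarrow>
        (\<forall>r\<in>replicas P. (owner P, r, Query x) \<in> sent (s (Suc j)))"
      using x by (rule eventually_mono) (auto elim!: act.cases)
  qed (use sent_mono in auto)
  then obtain i' where "\<forall>r\<in>replicas P. (owner P, r, Query (hash P (ModelV w))) \<in> sent (s i')"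
    using eventually_witness w(2) by blast
  then have ret: "\<forall>\<^sub>F j in sequentially. retrieved P (s j) (owner P) x (ModelV w)"
    using retrieve[OF w(1,3) owner_correct] w(2) by blast
  obtain N where N: "\<forall>j\<ge>N. final_model_hash P (ledger (s j)) = Some x \<and>
      retrieved P (s j) (owner P) x (ModelV w)"
    using eventually_conj[OF x ret] unfolding eventually_sequentially by blast
  \<comment> \<open>Fairness is applied directly instead of through \<open>progress\<close>: the
    read has to happen after time \<open>i\<close>, and \<open>owner_read\<close> stays enabled even
    after it has been executed.\<close>
  have "\<forall>j\<ge>max N i. \<exists>s'. act P OwnerRead (s j) s'"
    using N by (auto intro: act.owner_read)
  then obtain j where j: "j \<ge> max N i" "act P OwnerRead (s j) (s (Suc j))"
    using fair unfolding fair_def by (metis voluntary.simps)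
  then have fin: "final_model_hash P (ledger (s j)) = Some x"
    using N by simp
  \<comment> \<open>The owner may have read through any replica, but a model that hashes to
    \<open>x\<close> can only be \<open>w\<close>.\<close>
  have "obtained (s (Suc j)) = Some w" "ledger (s (Suc j)) = ledger (s j)"
    using j(2) fin w(2) by (auto elim!: act.cases simp: retrieved_def)
  moreover have "\<exists>y\<in>set (ledger (s j)). valid_final P y \<and> final_hash y = Some (hash P (ModelV w))"
    using fin w(2) by (fastforce simp: final_model_hash_def Option.bind_eq_Some_conv dest: find_SomeD)
  ultimately have "obtains_trained_model P (s (Suc j)) w"
    by (simp add: obtains_trained_model_def)
  then show ?thesis
    using j(1) by (intro exI[of _ "Suc j"]) auto
qed

end

theorem theorem2:
  fixes P :: "('p, 'g, 'n::finite, 'i, 'h) system"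
    and s :: "nat \<Rightarrow> ('p, 'g, 'n, 'i, 'h) state"
  assumes "well_formed P"
    and "card (servers P) = 2 * f_s P + 1" and "card (servers P \<inter> byz P) \<le> f_s P"
    and "card (replicas P) = f_r P + 1" and "card (replicas P \<inter> byz P) \<le> f_r P"
    and "execution P s"
    and "models_close P s"
    and "clients_suffice P s"
    and "task_set_up P s i"
  shows "\<exists>j>i. \<exists>w. obtains_trained_model P (s j) w"
proof -
  interpret task_run P s i
    by unfold_locales (use assms in auto)
  show ?thesis
    by (rule model_obtained)
qed

end
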